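(* Let $M$ be a spherical analytic real hypersurface with definite Levi form in a complex manifold of dimension $n+1$, let $U$ be a connected neighborhood of a point $p\in M$, and let $\phi$ be a biholomorphic mapping on $U$ such that $\phi(U\cap M)\subset S^{2n+1}$. Then $\phi$ continues holomorphically along any path in $M$ (starting at $p$) as a locally biholomorphic mapping.
   Context: Here $n\ge1$ and $S^{2n+1}\subset\mathbb{C}^{n+1}$ is the unit sphere. A biholomorphic mapping on $U$ is a holomorphic map from $U$ that is biholomorphic onto an open subset of $\mathbb{C}^{n+1}$. A real hyperquadric is $\{(z,w)\in\mathbb{C}^n\times\mathbb{C}:\mathrm{Im}\,w=\langle z,z\rangle\}$ with $\langle z,z\rangle=\sum_{\alpha\le e}|z^\alpha|^2-\sum_{\alpha>e}|z^\alpha|^2$. A nondegenerate analytic real hypersurface is spherical if at each of its points it is locally biholomorphic to a real hyperquadric. Continuation of $\phi$ along a path $\gamma:[0,1]\to M$, $\gamma(0)=p$, as a locally biholomorphic mapping: a family of germs $\phi_t$ at $\gamma(t)$ of locally biholomorphic maps, $\phi_0$ being the germ of $\phi$, such that for each $t$ the germs $\phi_s$ with $s$ near $t$ are all germs of one representative of $\phi_t$. *)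

theory Defs
  imports "HOL-Analysis.Analysis"
begin

text \<open>
  The model space \<open>C\<^sup>n \<times> C\<close> of dimension \<open>n + 1\<close>, where \<open>n = CARD('n) \<ge> 1\<close>. Its library norm is
  the Euclidean one, so \<^term>\<open>sphere 0 1\<close> is the unit sphere of real dimension \<open>2n + 1\<close>.
\<close>

type_synonym 'n cspace = "(complex ^ 'n) \<times> complex"

definition cscale :: "complex \<Rightarrow> 'n::finite cspace \<Rightarrow> 'n cspace" where
  "cscale c x = (c *s fst x, c * snd x)"

definition holomorphic_map_on :: "('n::finite cspace \<Rightarrow> 'n cspace) \<Rightarrow> 'n cspace set \<Rightarrow> bool" where
  "holomorphic_map_on f S \<longleftrightarrow>
     open S \<and>
     (\<forall>x\<in>S. \<exists>D. (f has_derivative D) (at x) \<and> (\<forall>c v. D (cscale c v) = cscale c (D v)))"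

subsection \<open>Complex manifolds and maps into the model space\<close>

text \<open>
  A complex manifold is a Hausdorff type \<open>'a\<close> with an atlas of pairs \<open>(V, \<kappa>)\<close>; only the values of
  \<open>\<kappa>\<close> on \<open>V\<close> matter. Neither second countability nor connectedness is assumed.
\<close>

definition complex_atlas :: "('a::t2_space set \<times> ('a \<Rightarrow> 'n::finite cspace)) set \<Rightarrow> bool" where
  "complex_atlas A \<longleftrightarrow>
     (\<Union>(V, \<kappa>)\<in>A. V) = UNIV \<and>
     (\<forall>(V, \<kappa>)\<in>A. open V \<and> open (\<kappa> ` V) \<and> homeomorphism V (\<kappa> ` V) \<kappa> (inv_into V \<kappa>)) \<and>
     (\<forall>(V, \<kappa>)\<in>A. \<forall>(V', \<kappa>')\<in>A.
        holomorphic_map_on (\<kappa>' \<circ> inv_into V \<kappa>) (\<kappa> ` (V \<inter> V')))"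

definition mfd_holomorphic_on ::
    "('a::t2_space set \<times> ('a \<Rightarrow> 'n::finite cspace)) set \<Rightarrow> ('a \<Rightarrow> 'n cspace) \<Rightarrow> 'a set \<Rightarrow> bool" where
  "mfd_holomorphic_on A f W \<longleftrightarrow>
     open W \<and> (\<forall>(V, \<kappa>)\<in>A. holomorphic_map_on (f \<circ> inv_into V \<kappa>) (\<kappa> ` (V \<inter> W)))"

text \<open>Biholomorphic onto an open subset of the model space.\<close>

definition biholomorphic_on ::
    "('a::t2_space set \<times> ('a \<Rightarrow> 'n::finite cspace)) set \<Rightarrow> ('a \<Rightarrow> 'n cspace) \<Rightarrow> 'a set \<Rightarrow> bool" where
  "biholomorphic_on A f W \<longleftrightarrow>
     mfd_holomorphic_on A f W \<and> inj_on f W \<and> open (f ` W) \<and>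
     continuous_on (f ` W) (inv_into W f) \<and>
     (\<forall>(V, \<kappa>)\<in>A. holomorphic_map_on (\<kappa> \<circ> inv_into W f) (f ` (W \<inter> V)))"

definition locally_biholomorphic_on ::
    "('a::t2_space set \<times> ('a \<Rightarrow> 'n::finite cspace)) set \<Rightarrow> ('a \<Rightarrow> 'n cspace) \<Rightarrow> 'a set \<Rightarrow> bool" where
  "locally_biholomorphic_on A f W \<longleftrightarrow>
     open W \<and> (\<forall>q\<in>W. \<exists>W'. q \<in> W' \<and> W' \<subseteq> W \<and> biholomorphic_on A f W')"

subsection \<open>Analytic real hypersurfaces and the Levi form\<close>

text \<open>
  Real analyticity: near each point, \<open>f\<close> is the sum of a power series over multi-indices
  \<open>\<alpha>\<close>, which are functions on the basis, set to \<open>0\<close> off the basis.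
\<close>

definition real_analytic_on :: "('b::euclidean_space \<Rightarrow> real) \<Rightarrow> 'b set \<Rightarrow> bool" where
  "real_analytic_on f S \<longleftrightarrow>
     open S \<and>
     (\<forall>x\<in>S. \<exists>\<epsilon>>0. \<exists>c :: ('b \<Rightarrow> nat) \<Rightarrow> real. \<forall>y\<in>ball x \<epsilon>.
        ((\<lambda>\<alpha>. c \<alpha> * (\<Prod>i\<in>Basis. ((y - x) \<bullet> i) ^ \<alpha> i)) has_sum f y)
          {\<alpha>. \<forall>i. i \<notin> Basis \<longrightarrow> \<alpha> i = 0})"

definition defining_function ::
    "'n::finite cspace set \<Rightarrow> 'n cspace set \<Rightarrow> ('n cspace \<Rightarrow> real) \<Rightarrow> bool" where
  "defining_function S W r \<longleftrightarrow>
     real_analytic_on r W \<and> S \<inter> W = {x \<in> W. r x = 0} \<and>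
     (\<forall>x\<in>W. frechet_derivative r (at x) \<noteq> (\<lambda>v. 0))"

definition local_defining_function ::
    "('a::t2_space set \<times> ('a \<Rightarrow> 'n::finite cspace)) set \<Rightarrow> 'a set \<Rightarrow> 'a \<Rightarrow>
       'a set \<times> ('a \<Rightarrow> 'n cspace) \<Rightarrow> ('n cspace \<Rightarrow> real) \<Rightarrow> bool" where
  "local_defining_function A M q C r \<longleftrightarrow>
     (case C of (V, \<kappa>) \<Rightarrow>
        (V, \<kappa>) \<in> A \<and> q \<in> V \<and>
        (\<exists>W. \<kappa> q \<in> W \<and> W \<subseteq> \<kappa> ` V \<and> defining_function (\<kappa> ` (V \<inter> M)) W r))"

definition analytic_hypersurface ::
    "('a::t2_space set \<times> ('a \<Rightarrow> 'n::finite cspace)) set \<Rightarrow> 'a set \<Rightarrow> bool" where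
  "analytic_hypersurface A M \<longleftrightarrow> (\<forall>q\<in>M. \<exists>C r. local_defining_function A M q C r)"

text \<open>
  The Wirtinger derivatives of \<open>f\<close> at \<open>x\<close> in direction \<open>v\<close>: \<open>\<Sum>\<^sub>j v\<^sub>j \<partial>f/\<partial>z\<^sub>j\<close> and \<open>\<Sum>\<^sub>j (cnj v\<^sub>j) \<partial>f/\<partial>(cnj z\<^sub>j)\<close>.
\<close>

definition d_z :: "('n::finite cspace \<Rightarrow> complex) \<Rightarrow> 'n cspace \<Rightarrow> 'n cspace \<Rightarrow> complex" where
  "d_z f x v = (frechet_derivative f (at x) v - \<i> * frechet_derivative f (at x) (cscale \<i> v)) / 2"

definition d_zbar :: "('n::finite cspace \<Rightarrow> complex) \<Rightarrow> 'n cspace \<Rightarrow> 'n cspace \<Rightarrow> complex" where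
  "d_zbar f x v = (frechet_derivative f (at x) v + \<i> * frechet_derivative f (at x) (cscale \<i> v)) / 2"

definition hol_tangent :: "('n::finite cspace \<Rightarrow> real) \<Rightarrow> 'n cspace \<Rightarrow> 'n cspace set" where
  "hol_tangent r x = {v. d_z (\<lambda>y. complex_of_real (r y)) x v = 0}"

text \<open>The Hermitian form \<open>\<Sum>\<^sub>j\<^sub>k (\<partial>\<^sup>2r/\<partial>z\<^sub>j\<partial>(cnj z\<^sub>k)) v\<^sub>j (cnj w\<^sub>k)\<close>.\<close>

definition levi_form :: "('n::finite cspace \<Rightarrow> real) \<Rightarrow> 'n cspace \<Rightarrow> 'n cspace \<Rightarrow> 'n cspace \<Rightarrow> complex" where
  "levi_form r x v w = d_z (\<lambda>y. d_zbar (\<lambda>u. complex_of_real (r u)) y w) x v"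

text \<open>
  Changing the chart or the defining function changes the Levi form by a linear isomorphism of the
  holomorphic tangent spaces and a nonzero real factor. Nondegeneracy and definiteness (of either
  sign) are therefore independent of these choices, and are stated for some choice.
\<close>

definition levi_nondegenerate ::
    "('a::t2_space set \<times> ('a \<Rightarrow> 'n::finite cspace)) set \<Rightarrow> 'a set \<Rightarrow> bool" where
  "levi_nondegenerate A M \<longleftrightarrow>
     (\<forall>q\<in>M. \<exists>V \<kappa> r. local_defining_function A M q (V, \<kappa>) r \<and>
        (\<forall>v\<in>hol_tangent r (\<kappa> q).
           (\<forall>w\<in>hol_tangent r (\<kappa> q). levi_form r (\<kappa> q) v w = 0) \<longrightarrow> v = 0))"

definition levi_definite ::
    "('a::t2_space set \<times> ('a \<Rightarrow> 'n::finite cspace)) set \<Rightarrow> 'a set \<Rightarrow> bool" where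
  "levi_definite A M \<longleftrightarrow>
     (\<forall>q\<in>M. \<exists>V \<kappa> r. local_defining_function A M q (V, \<kappa>) r \<and>
        ((\<forall>v\<in>hol_tangent r (\<kappa> q) - {0}. Re (levi_form r (\<kappa> q) v v) > 0) \<or>
         (\<forall>v\<in>hol_tangent r (\<kappa> q) - {0}. Re (levi_form r (\<kappa> q) v v) < 0)))"

subsection \<open>Spherical hypersurfaces\<close>

text \<open>
  The coordinates of \<open>C\<^sup>n\<close> are indexed by an unordered finite type, so the set \<open>P\<close> of coordinates
  carrying a plus sign takes the place of \<open>{1..e}\<close>.
\<close>

definition hyperquadric :: "'n::finite set \<Rightarrow> 'n cspace set" where
  "hyperquadric P =
     {(z, w). Im w = (\<Sum>\<alpha>\<in>P. (cmod (z $ \<alpha>))\<^sup>2) - (\<Sum>\<alpha>\<in>-P. (cmod (z $ \<alpha>))\<^sup>2)}"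

definition spherical ::
    "('a::t2_space set \<times> ('a \<Rightarrow> 'n::finite cspace)) set \<Rightarrow> 'a set \<Rightarrow> bool" where
  "spherical A M \<longleftrightarrow>
     analytic_hypersurface A M \<and> levi_nondegenerate A M \<and>
     (\<forall>q\<in>M. \<exists>W \<psi> P. q \<in> W \<and> biholomorphic_on A \<psi> W \<and> \<psi> ` (W \<inter> M) = \<psi> ` W \<inter> hyperquadric P)"

subsection \<open>Continuation along a path\<close>

definition germ_at :: "'a::t2_space \<Rightarrow> ('a \<Rightarrow> 'b) \<Rightarrow> ('a \<Rightarrow> 'b) set" where
  "germ_at q f = {g. \<forall>\<^sub>F x in nhds q. g x = f x}"

definition continues_along ::
    "('a::t2_space set \<times> ('a \<Rightarrow> 'n::finite cspace)) set \<Rightarrow> ('a \<Rightarrow> 'n cspace) \<Rightarrow> (real \<Rightarrow> 'a) \<Rightarrow> bool" where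
  "continues_along A \<phi> \<gamma> \<longleftrightarrow>
     (\<exists>\<Phi> :: real \<Rightarrow> ('a \<Rightarrow> 'n cspace) set.
        \<Phi> 0 = germ_at (\<gamma> 0) \<phi> \<and>
        (\<forall>t\<in>{0..1}. \<exists>N G.
           \<gamma> t \<in> N \<and> locally_biholomorphic_on A G N \<and> \<Phi> t = germ_at (\<gamma> t) G \<and>
           (\<forall>\<^sub>F s in at t within {0..1}. \<gamma> s \<in> N \<and> \<Phi> s = germ_at (\<gamma> s) G)))"

end

theory Submission
  imports Defs "HOL-Complex_Analysis.Conformal_Mappings"
begin

text \<open>
  Near each of its points \<open>M\<close> is carried by a local coordinate map \<open>\<psi>\<close> onto a piece of a hyperquadric \<open>Q\<close>.
  A germ that maps \<open>M\<close> into the sphere becomes, through \<open>\<psi>\<close>, a locally biholomorphic map \<open>f\<close> that sends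
  a piece of \<open>Q\<close> into the sphere. Everything rests on the rigidity of such maps
  (\<open>linear_fractional\<close>, in the spirit of Poincare, Tanaka and Alexander): \<open>f\<close> is a quotient \<open>p / \<sigma>\<close> of
  complex affine functions, \<open>\<sigma>\<close> vanishes nowhere on \<open>Q\<close>, and \<open>p / \<sigma>\<close> is biholomorphic wherever \<open>\<sigma> \<noteq> 0\<close>.
  So a germ given at one point of \<open>M\<close> in the domain of \<open>\<psi>\<close> extends at once to all points of \<open>M\<close> in that
  domain (\<open>extension_over_spherical_chart\<close>). The size of the domain does not depend on the germ, and
  compactness of the interval then yields the continuation along the whole path.

  The rigidity is a statement of projective geometry. Polarising the equation of \<open>Q\<close> gives a function
  \<open>segre P Z Y\<close>, affine in \<open>Z\<close> and conjugate affine in \<open>Y\<close>, and the zero sets in \<open>Z\<close> (Segre varieties) are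
  complex hyperplanes. The relation \<open>|f|\<^sup>2 = 1\<close> on \<open>Q\<close> polarises to \<open>\<langle>f Z, f Y\<rangle> = 1\<close> whenever
  \<open>segre P Z Y = 0\<close> (\<open>hermitian_eq_1_on_segre\<close>), so \<open>f\<close> maps hyperplanes into hyperplanes, and hence
  should be projective. Holomorphy makes this quick. The first derivative in \<open>Y\<close> of the polarised
  identity shows that on the Segre variety of a fixed \<open>Y\<close>
    \<open>\<langle>f Z, f Y'\<rangle> - 1 = h Z * m Y' * segre P Z Y'\<close>
  (\<open>hermitian_factor_on_segre\<close>). Two points \<open>Z\<close> and \<open>0\<close> on a common Segre variety therefore see the same
  cross ratios (\<open>cross_ratio_identity\<close>), and differentiating this identity in \<open>Y'\<close> at one point \<open>Ys\<close>
  exhibits \<open>\<sigma> Z = segre P Z Ys / (\<langle>f Z, f Ys\<rangle> - 1)\<close> as a factor that makes \<open>\<sigma> f\<close> affine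
  (\<open>linear_fractional_on_open\<close>).

  Finally \<open>\<langle>p Z, p Y\<rangle> - \<sigma> Z * cnj (\<sigma> Y)\<close> vanishes where \<open>segre P Z Y\<close> does, and so is a
  multiple of it for all \<open>Z\<close> and \<open>Y\<close> (\<open>hermitian_form_proportional_to_segre\<close>); the factor is not \<open>0\<close>
  because \<open>f\<close> does not map an open set into a hyperplane. This one identity
  controls \<open>p / \<sigma>\<close> globally: as \<open>segre P\<close> is nondegenerate, \<open>p\<close> and \<open>\<sigma>\<close> have no common zero, and \<open>p / \<sigma>\<close>
  is injective with injective derivative; on \<open>Q\<close> it gives \<open>|p| = |\<sigma>|\<close>, so that \<open>\<sigma> \<noteq> 0\<close> there and \<open>Q\<close> is
  mapped into the sphere.
\<close>

section \<open>Hermitian forms and Segre varieties\<close>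

text \<open>
  The complex Hermitian inner product whose real part is the library inner product of the model space,
  linear in the first argument.
\<close>

definition hermitian :: "'n::finite cspace \<Rightarrow> 'n cspace \<Rightarrow> complex" where
  "hermitian x y = (\<Sum>i\<in>UNIV. fst x $ i * cnj (fst y $ i)) + snd x * cnj (snd y)"

definition qform :: "'n::finite set \<Rightarrow> complex ^ 'n \<Rightarrow> complex ^ 'n \<Rightarrow> complex" where
  "qform P z y = (\<Sum>i\<in>UNIV. (if i \<in> P then 1 else - 1) * (z $ i * cnj (y $ i)))"

text \<open>
  The polarised equation of \<open>hyperquadric P\<close>, to which it reduces for \<open>Z = Y\<close>. For fixed \<open>Y\<close>
  its zero set in \<open>Z\<close> is the Segre variety of \<open>Y\<close>, a complex affine hyperplane.
\<close>

definition segre :: "'n::finite set \<Rightarrow> 'n cspace \<Rightarrow> 'n cspace \<Rightarrow> complex" where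
  "segre P Z Y = snd Z - cnj (snd Y) - 2 * \<i> * qform P (fst Z) (fst Y)"

lemma cscale_simps [simp]:
  "fst (cscale c x) = c *s fst x" "snd (cscale c x) = c * snd x"
  by (simp_all add: cscale_def)

lemma cscale_alg:
  "cscale 1 x = x" "cscale 0 x = 0" "cscale c 0 = 0" "cscale a (cscale b x) = cscale (a * b) x"
  "cscale c (x + y) = cscale c x + cscale c y" "cscale c (x - y) = cscale c x - cscale c y"
  "cscale (a + b) x = cscale a x + cscale b x" "cscale (a - b) x = cscale a x - cscale b x"
  "cscale c (- x) = - cscale c x"
  by (auto simp: prod_eq_iff vec_eq_iff algebra_simps)

lemma scaleR_cscale: "r *\<^sub>R x = cscale (of_real r) x"
  by (auto simp: prod_eq_iff vec_eq_iff) (simp_all add: scaleR_conv_of_real)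

lemma hermitian_add: "hermitian (x + y) z = hermitian x z + hermitian y z" "hermitian x (y + z) = hermitian x y + hermitian x z"
  by (simp_all add: hermitian_def algebra_simps sum.distrib)

lemma hermitian_scale: "hermitian (cscale c x) y = c * hermitian x y" "hermitian x (cscale c y) = cnj c * hermitian x y"
  by (simp_all add: hermitian_def algebra_simps sum_distrib_left)

lemma hermitian_minus: "hermitian (- x) y = - hermitian x y" "hermitian x (- y) = - hermitian x y"
  by (simp_all add: hermitian_def sum_negf)

lemma hermitian_diff: "hermitian (x - y) z = hermitian x z - hermitian y z" "hermitian x (y - z) = hermitian x y - hermitian x z"
  using hermitian_add(1)[of x "-y" z] hermitian_add(2)[of x y "-z"] by (simp_all add: hermitian_minus)

lemma hermitian_0 [simp]: "hermitian 0 x = 0" "hermitian x 0 = 0"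
  by (simp_all add: hermitian_def)

lemma hermitian_cnj: "cnj (hermitian x y) = hermitian y x"
  by (simp add: hermitian_def mult.commute)

lemma qform_add: "qform P (x + y) z = qform P x z + qform P y z" "qform P x (y + z) = qform P x y + qform P x z"
  by (simp_all add: qform_def algebra_simps sum.distrib)

lemma qform_scale: "qform P (c *s x) y = c * qform P x y" "qform P x (c *s y) = cnj c * qform P x y"
  by (simp_all add: qform_def algebra_simps sum_distrib_left)

lemma qform_minus: "qform P (- x) y = - qform P x y" "qform P x (- y) = - qform P x y"
  by (simp_all add: qform_def sum_negf)

lemma qform_diff: "qform P (x - y) z = qform P x z - qform P y z" "qform P x (y - z) = qform P x y - qform P x z"
  using qform_add(1)[of P x "-y" z] qform_add(2)[of P x y "-z"] by (simp_all add: qform_minus)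

lemma qform_0 [simp]: "qform P 0 x = 0" "qform P x 0 = 0"
  by (simp_all add: qform_def)

lemma qform_cnj: "cnj (qform P x y) = qform P y x"
  unfolding qform_def cnj_sum by (rule sum.cong) (auto simp: mult.commute)

lemma norm_cspace: "(norm (x :: 'n::finite cspace))\<^sup>2 = (\<Sum>i\<in>UNIV. (cmod (fst x $ i))\<^sup>2) + (cmod (snd x))\<^sup>2"
  by (simp add: norm_prod_def norm_vec_def L2_set_def sum_nonneg)

lemma hermitian_self: "hermitian x x = of_real ((norm x)\<^sup>2)"
  unfolding norm_cspace hermitian_def by (simp add: complex_norm_square del: of_real_power)

lemma hermitian_eq_0: "(\<And>u. hermitian x u = 0) \<Longrightarrow> x = 0"
  using hermitian_self[of x] by simp

lemma segre_cnj: "cnj (segre P Z Y) = - segre P Y Z"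
  by (simp add: segre_def qform_cnj)

lemma hyperquadric_iff_segre: "Z \<in> hyperquadric P \<longleftrightarrow> segre P Z Z = 0"
proof -
  have split: "(\<Sum>i\<in>UNIV. h i) = (\<Sum>i\<in>P. h i) + (\<Sum>i\<in>-P. h i)" for h :: "'a \<Rightarrow> complex"
    by (metis Compl_eq_Diff_UNIV finite subset_UNIV sum.subset_diff add.commute)
  have "qform P (fst Z) (fst Z) = of_real ((\<Sum>\<alpha>\<in>P. (cmod (fst Z $ \<alpha>))\<^sup>2) - (\<Sum>\<alpha>\<in>-P. (cmod (fst Z $ \<alpha>))\<^sup>2))"
    unfolding qform_def split by (simp add: sum_negf complex_norm_square del: of_real_power)
  moreover have "snd Z - cnj (snd Z) = 2 * \<i> * of_real (Im (snd Z))"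
    by (simp add: complex_eq_iff)
  ultimately have "segre P Z Z = 2 * \<i> * of_real (Im (snd Z) -
      ((\<Sum>\<alpha>\<in>P. (cmod (fst Z $ \<alpha>))\<^sup>2) - (\<Sum>\<alpha>\<in>-P. (cmod (fst Z $ \<alpha>))\<^sup>2)))"
    unfolding segre_def by (simp only: of_real_diff right_diff_distrib)
  then have "segre P Z Z = 0 \<longleftrightarrow> Im (snd Z) =
      (\<Sum>\<alpha>\<in>P. (cmod (fst Z $ \<alpha>))\<^sup>2) - (\<Sum>\<alpha>\<in>-P. (cmod (fst Z $ \<alpha>))\<^sup>2)"
    by (simp only: mult_eq_0_iff of_real_eq_0_iff) simp
  then show ?thesis
    by (simp add: hyperquadric_def case_prod_unfold)
qed

lemma bounded_bilinear_hermitian: "bounded_bilinear hermitian"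
proof -
  have "bilinear (hermitian :: 'a::finite cspace \<Rightarrow> _)"
    unfolding bilinear_def
    by (intro conjI allI linearI) (simp_all only: hermitian_add scaleR_cscale hermitian_scale, simp_all add: scaleR_conv_of_real)
  then show ?thesis by (simp add: bilinear_conv_bounded_bilinear)
qed

lemma bounded_bilinear_qform: "bounded_bilinear (qform P)"
proof -
  have "r *\<^sub>R x = of_real r *s x" for r and x :: "complex ^ 'a"
    by (simp only: vec_eq_iff vector_scaleR_component vector_smult_component) (simp add: scaleR_conv_of_real)
  then have "bilinear (qform P)"
    unfolding bilinear_def
    by (intro conjI allI linearI) (simp_all only: qform_add qform_scale, simp_all add: scaleR_conv_of_real)
  then show ?thesis by (simp add: bilinear_conv_bounded_bilinear)
qed

lemma bounded_bilinear_cscale: "bounded_bilinear cscale"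
proof -
  have "bilinear (cscale :: complex \<Rightarrow> 'a::finite cspace \<Rightarrow> _)"
    unfolding bilinear_def
    by (intro conjI allI linearI)
      (simp_all only: cscale_alg scaleR_cscale scaleR_conv_of_real[where 'a = complex] mult.commute)
  then show ?thesis by (simp add: bilinear_conv_bounded_bilinear)
qed

lemmas hermitian_has_derivative [derivative_intros] = bounded_bilinear.FDERIV[OF bounded_bilinear_hermitian]
lemmas qform_has_derivative [derivative_intros] = bounded_bilinear.FDERIV[OF bounded_bilinear_qform]
lemmas cscale_has_derivative [derivative_intros] = bounded_bilinear.FDERIV[OF bounded_bilinear_cscale]
lemmas continuous_on_hermitian [continuous_intros] = bounded_bilinear.continuous_on[OF bounded_bilinear_hermitian]
lemmas continuous_on_qform [continuous_intros] = bounded_bilinear.continuous_on[OF bounded_bilinear_qform]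
lemmas continuous_on_cscale [continuous_intros] = bounded_bilinear.continuous_on[OF bounded_bilinear_cscale]

lemma continuous_on_segre [continuous_intros]:
  "continuous_on S f \<Longrightarrow> continuous_on S g \<Longrightarrow> continuous_on S (\<lambda>x. segre P (f x) (g x))"
  unfolding segre_def by (intro continuous_intros)

section \<open>Complex affine functions\<close>

text \<open>
  Stated through \<open>F\<close> alone, so that neither the constant term nor the linear part \<open>\<lambda>u. F u - F 0\<close>
  has to be carried around.
\<close>

definition complex_affine :: "('n::finite cspace \<Rightarrow> complex) \<Rightarrow> bool" where
  "complex_affine F \<longleftrightarrow> (\<forall>x y. F (x + y) + F 0 = F x + F y) \<and> (\<forall>c x. F (cscale c x) = F 0 + c * (F x - F 0))"

definition complex_affine_map :: "('n::finite cspace \<Rightarrow> 'n cspace) \<Rightarrow> bool" where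
  "complex_affine_map F \<longleftrightarrow> (\<forall>x y. F (x + y) + F 0 = F x + F y) \<and>
     (\<forall>c x. F (cscale c x) = F 0 + cscale c (F x - F 0))"

lemma complex_affine_plus: "complex_affine F \<Longrightarrow> F (x + y) = F x + F y - F 0"
  unfolding complex_affine_def by (metis add_diff_cancel_right')

lemma complex_affine_cscale: "complex_affine F \<Longrightarrow> F (cscale c x) = F 0 + c * (F x - F 0)"
  unfolding complex_affine_def by blast

lemma complex_affineI:
  "(\<And>x y. F (x + y) = F x + F y - F 0) \<Longrightarrow> (\<And>c x. F (cscale c x) = F 0 + c * (F x - F 0)) \<Longrightarrow> complex_affine F"
  unfolding complex_affine_def by simp

lemma complex_affineD: "complex_affine F \<Longrightarrow> F (x + cscale c u) = F x + c * (F u - F 0)"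
  by (simp add: complex_affine_plus complex_affine_cscale)

lemma complex_affine_map_plus: "complex_affine_map F \<Longrightarrow> F (x + y) = F x + F y - F 0"
  unfolding complex_affine_map_def by (metis add_diff_cancel_right')

lemma complex_affine_map_cscale: "complex_affine_map F \<Longrightarrow> F (cscale c x) = F 0 + cscale c (F x - F 0)"
  unfolding complex_affine_map_def by blast

lemma complex_affine_mapD: "complex_affine_map F \<Longrightarrow> F (x + cscale c u) = F x + cscale c (F u - F 0)"
  by (simp only: complex_affine_map_plus complex_affine_map_cscale) simp

lemma complex_affine_has_derivative:
  assumes "complex_affine F" shows "(F has_derivative (\<lambda>u. F u - F 0)) (at x)"
proof -
  have "linear (\<lambda>u. F u - F 0)"
  proof (rule linearI)
    show "F (x + y) - F 0 = F x - F 0 + (F y - F 0)" for x y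
      using complex_affineD[OF assms, of x 1 y] by (simp add: cscale_alg)
    show "F (r *\<^sub>R x) - F 0 = r *\<^sub>R (F x - F 0)" for r x
      using complex_affineD[OF assms, of 0 "of_real r" x] by (simp add: scaleR_cscale scaleR_conv_of_real[of r "_ - _"])
  qed
  then have "((\<lambda>x. F x - F 0) has_derivative (\<lambda>u. F u - F 0)) (at x)"
    by (simp add: linear_imp_has_derivative)
  from has_derivative_add[OF this has_derivative_const[of "F 0"]] show ?thesis by simp
qed

lemma complex_affine_map_has_derivative:
  assumes "complex_affine_map F" shows "(F has_derivative (\<lambda>u. F u - F 0)) (at x)"
proof -
  have "linear (\<lambda>u. F u - F 0)"
  proof (rule linearI)
    show "F (x + y) - F 0 = F x - F 0 + (F y - F 0)" for x y
      using complex_affine_mapD[OF assms, of x 1 y] by (simp add: cscale_alg)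
    show "F (r *\<^sub>R x) - F 0 = r *\<^sub>R (F x - F 0)" for r x
      using complex_affine_mapD[OF assms, of 0 "of_real r" x] by (simp add: scaleR_cscale cscale_alg)
  qed
  then have "((\<lambda>x. F x - F 0) has_derivative (\<lambda>u. F u - F 0)) (at x)"
    by (simp add: linear_imp_has_derivative)
  from has_derivative_add[OF this has_derivative_const[of "F 0"]] show ?thesis by simp
qed

lemma small_step_in_open:
  assumes "open S" "z \<in> S"
  shows "\<exists>c. c \<noteq> 0 \<and> z + cscale c u \<in> S"
proof -
  have "continuous_on UNIV (\<lambda>t. z + t *\<^sub>R u)" by (intro continuous_intros)
  then have "open ((\<lambda>t. z + t *\<^sub>R u) -` S)" using assms by (simp add: open_vimage)
  moreover have "(0::real) \<in> (\<lambda>t. z + t *\<^sub>R u) -` S" using assms by simp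
  ultimately obtain e where e: "e > 0" "ball 0 e \<subseteq> (\<lambda>t. z + t *\<^sub>R u) -` S"
    by (meson open_contains_ball)
  then have "z + (e/2) *\<^sub>R u \<in> S" by (auto simp: subset_iff)
  then show ?thesis using e by (intro exI[of _ "of_real (e/2)"]) (simp add: scaleR_cscale)
qed

text \<open>
  Vanishing near a single zero of \<open>G\<close> suffices: centred at that zero both functions are linear, so the
  kernel of \<open>G\<close> lies in the kernel of \<open>F\<close> by scaling, and a linear form is determined up to a factor by
  its kernel.
\<close>

lemma complex_affine_multiple_if_vanishing:
  assumes F: "complex_affine F" and G: "complex_affine G" and S: "open S" "z0 \<in> S" "G z0 = 0"
    and van: "\<And>z. z \<in> S \<Longrightarrow> G z = 0 \<Longrightarrow> F z = 0" and non: "G a \<noteq> G b"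
  shows "\<exists>m. \<forall>z. F z = m * G z"
proof -
  define F' where "F' u = F u - F 0" for u
  define G' where "G' u = G u - G 0" for u
  have Fe: "F (z0 + cscale c u) = c * F' u" for c u
    using complex_affineD[OF F] van S by (simp add: F'_def)
  have Ge: "G (z0 + cscale c u) = c * G' u" for c u
    using complex_affineD[OF G] S by (simp add: G'_def)
  have ker: "F' u = 0" if "G' u = 0" for u
  proof -
    obtain c where c: "c \<noteq> 0" "z0 + cscale c u \<in> S" using small_step_in_open S by blast
    then have "F (z0 + cscale c u) = 0"
      using van Ge that by simp
    then show ?thesis using Fe c(1) by simp
  qed
  obtain v where v: "G' v \<noteq> 0" using non unfolding G'_def by (metis diff_add_cancel)
  show ?thesis
  proof (intro exI allI)
    fix z
    have "G (z0 + cscale 1 (z - z0)) = G' (z - z0)" "F (z0 + cscale 1 (z - z0)) = F' (z - z0)"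
      using Ge[of 1] Fe[of 1] by simp_all
    then have z: "G z = G' (z - z0)" "F z = F' (z - z0)" by (simp_all add: cscale_alg)
    define c where "c = G' (z - z0) / G' v"
    have "G' (x + cscale (-c) v) = G' x - c * G' v" "F' (x + cscale (-c) v) = F' x - c * F' v" for x
      using complex_affineD[OF G, of x "-c" v] complex_affineD[OF F, of x "-c" v]
      by (simp_all add: G'_def F'_def)
    from this[of "z - z0"] ker[of "z - z0 + cscale (-c) v"] have "F' (z - z0) = c * F' v"
      using v by (simp add: c_def)
    then show "F z = (F' v / G' v) * G z" using v by (simp add: z c_def field_simps)
  qed
qed

lemma complex_affine_segre: "complex_affine (\<lambda>Z. segre P Z Y)"
  by (simp add: complex_affine_def segre_def qform_add qform_scale algebra_simps)

lemma complex_affine_hermitian: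
  assumes "complex_affine_map F" shows "complex_affine (\<lambda>Z. hermitian (F Z) e)"
  by (rule complex_affineI) (simp_all only: complex_affine_map_plus[OF assms] complex_affine_map_cscale[OF assms]
      hermitian_add hermitian_diff hermitian_scale)

lemma complex_affine_add:
  assumes "complex_affine F" "complex_affine G" shows "complex_affine (\<lambda>Z. F Z + G Z)"
  by (rule complex_affineI) (simp_all only: complex_affine_plus[OF assms(1)] complex_affine_plus[OF assms(2)]
      complex_affine_cscale[OF assms(1)] complex_affine_cscale[OF assms(2)], simp_all add: algebra_simps)

lemma complex_affine_cmult:
  assumes "complex_affine F" shows "complex_affine (\<lambda>Z. c * F Z)"
  by (rule complex_affineI) (simp_all only: complex_affine_plus[OF assms] complex_affine_cscale[OF assms],
      simp_all add: algebra_simps)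

lemma complex_affine_diff: "complex_affine F \<Longrightarrow> complex_affine G \<Longrightarrow> complex_affine (\<lambda>Z. F Z - G Z)"
  using complex_affine_add[of F "\<lambda>Z. -1 * G Z"] complex_affine_cmult[of G "-1"] by simp

text \<open>
  By homogeneity an affine function that vanishes near one point vanishes along each line through it.
\<close>

lemma complex_affine_eq_0:
  assumes "complex_affine F" "open S" "z0 \<in> S" "\<And>z. z \<in> S \<Longrightarrow> F z = 0"
  shows "F z = 0"
proof -
  obtain c where c: "c \<noteq> 0" "z0 + cscale c (z - z0) \<in> S" using small_step_in_open assms by blast
  then have "F (z - z0) - F 0 = 0" using complex_affineD[OF assms(1), of z0 c "z - z0"] assms(3,4) by simp
  moreover have "F (z0 + cscale 1 (z - z0)) = F z" by (simp add: cscale_alg)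
  ultimately show ?thesis using complex_affineD[OF assms(1), of z0 1 "z - z0"] assms(3,4) by simp
qed

section \<open>Polarisation of the sphere relation\<close>

lemma norm_cscale: "norm (cscale c x) = cmod c * norm x"
proof -
  have "complex_of_real ((norm (cscale c x))\<^sup>2) = of_real ((cmod c * norm x)\<^sup>2)"
    unfolding hermitian_self[symmetric] hermitian_scale
    by (simp add: hermitian_self power_mult_distrib complex_norm_square mult.assoc del: of_real_power)
  then have "(norm (cscale c x))\<^sup>2 = (cmod c * norm x)\<^sup>2" by (simp only: of_real_eq_iff)
  then show ?thesis by (simp add: power2_eq_iff_nonneg)
qed

lemma norm_smult: "norm (c *s x :: complex ^ 'n::finite) = cmod c * norm x"
  using norm_cscale[of c "(x, 0)"] by (simp add: cscale_def norm_Pair)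

lemma hermitian_axis: "hermitian x (axis i 1, 0) = fst x $ i" "hermitian x (0, 1) = snd x"
proof -
  have "(\<Sum>j\<in>UNIV. fst x $ j * cnj (axis i 1 $ j)) = (\<Sum>j\<in>UNIV. if j = i then fst x $ j else 0)"
    by (intro sum.cong) (auto simp: axis_def)
  then show "hermitian x (axis i 1, 0) = fst x $ i" by (simp add: hermitian_def)
qed (simp add: hermitian_def)

lemma holomorphic_map_on_continuous: "holomorphic_map_on f S \<Longrightarrow> continuous_on S f"
  unfolding holomorphic_map_on_def
  by (meson continuous_at_imp_continuous_on has_derivative_continuous)

text \<open>
  Reduces statements about maps of several variables to functions of one variable, for which the
  identity theorem is available.
\<close>

lemma holomorphic_along_curve:
  assumes f: "holomorphic_map_on f S"
    and g: "\<And>\<tau>. \<tau> \<in> T \<Longrightarrow> g \<tau> \<in> S"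
      "\<And>\<tau>. \<tau> \<in> T \<Longrightarrow> (g has_derivative (\<lambda>c. cscale c (g' \<tau>))) (at \<tau>)"
  shows "(\<lambda>\<tau>. hermitian (f (g \<tau>)) e) holomorphic_on T"
proof -
  have "\<exists>d. ((\<lambda>\<tau>. hermitian (f (g \<tau>)) e) has_field_derivative d) (at \<tau> within T)" if t: "\<tau> \<in> T" for \<tau>
  proof -
    obtain D where D: "(f has_derivative D) (at (g \<tau>))" "\<And>c v. D (cscale c v) = cscale c (D v)"
      using f g(1)[OF t] unfolding holomorphic_map_on_def by blast
    have "((\<lambda>\<tau>. f (g \<tau>)) has_derivative (\<lambda>c. D (cscale c (g' \<tau>)))) (at \<tau>)"
      using has_derivative_compose[OF g(2)[OF t] D(1)] .
    then have "((\<lambda>\<tau>. hermitian (f (g \<tau>)) e) has_derivative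
        (\<lambda>c. hermitian (f (g \<tau>)) 0 + hermitian (D (cscale c (g' \<tau>))) e)) (at \<tau>)"
      by (intro derivative_intros) auto
    moreover have "(\<lambda>c. hermitian (f (g \<tau>)) 0 + hermitian (D (cscale c (g' \<tau>))) e) = (*) (hermitian (D (g' \<tau>)) e)"
      by (auto simp: D(2) hermitian_scale)
    ultimately show ?thesis
      unfolding has_field_derivative_def by (metis has_derivative_at_withinI)
  qed
  then show ?thesis unfolding holomorphic_on_def field_differentiable_def by blast
qed

text \<open>
  The identity theorem, obtained on the complex line through \<open>x\<close> and a point of \<open>Z\<close>; by convexity this
  line meets \<open>S\<close> in a connected set.
\<close>

lemma holomorphic_map_identity:
  assumes f: "holomorphic_map_on f S" and "convex S"
    and Z: "open Z" "Z \<noteq> {}" "Z \<subseteq> S" "\<And>z. z \<in> Z \<Longrightarrow> f z = 0" and x: "x \<in> S"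
  shows "f x = 0"
proof (rule hermitian_eq_0)
  fix e
  obtain z where z: "z \<in> Z" using Z by blast
  have oS: "open S" using f by (simp add: holomorphic_map_on_def)
  define g where "g \<tau> = z + cscale \<tau> (x - z)" for \<tau>
  have cg: "continuous_on UNIV g" unfolding g_def by (intro continuous_intros)
  have opn: "open (g -` S)" "open (g -` Z)" using open_vimage cg oS Z(1) by blast+
  have conv: "convex (g -` S)"
  proof (rule convexI)
    fix a b :: complex and u v :: real
    assume ab: "a \<in> g -` S" "b \<in> g -` S" and uv: "0 \<le> u" "0 \<le> v" "u + v = 1"
    have "u *\<^sub>R z + v *\<^sub>R z = z" using uv by (metis scaleR_add_left scaleR_one)
    then have "g (u *\<^sub>R a + v *\<^sub>R b) = u *\<^sub>R g a + v *\<^sub>R g b"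
      by (simp add: g_def scaleR_add_right scaleR_cscale cscale_alg scaleR_conv_of_real
          algebra_simps)
    then show "u *\<^sub>R a + v *\<^sub>R b \<in> g -` S"
      using convexD[OF \<open>convex S\<close>, of "g a" "g b" u v] ab uv by simp
  qed
  have g': "(g has_derivative (\<lambda>c. cscale c (x - z))) (at \<tau>)" for \<tau>
    unfolding g_def by (auto intro!: derivative_eq_intros simp: cscale_alg)
  have "(\<lambda>\<tau>. hermitian (f (g \<tau>)) e) holomorphic_on g -` S"
    by (rule holomorphic_along_curve[OF f _ g']) auto
  then have "hermitian (f (g 1)) e = 0"
  proof (rule analytic_continuation[where U = "g -` Z" and \<xi> = 0])
    show "connected (g -` S)" using conv by (rule convex_connected)
    show "g -` Z \<subseteq> g -` S" using Z by auto
    show "0 \<in> g -` S" using z Z by (auto simp: g_def cscale_alg)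
    show "0 islimpt g -` Z"
      by (rule interior_limit_point) (use z opn in \<open>auto simp: interior_open g_def cscale_alg\<close>)
    show "1 \<in> g -` S" using x by (simp add: g_def cscale_alg)
  qed (use opn Z in auto)
  then show "hermitian (f x) e = 0" by (simp add: g_def cscale_alg)
qed

text \<open>
  The pairs \<open>(Z, Y)\<close> with \<open>segre P Z Y = 0\<close> are the complexification of the hyperquadric, embedded as
  the diagonal. Through such a pair runs a curve \<open>g\<close>, polynomial of degree 2 in \<open>\<tau>\<close>, with
  \<open>g \<i> = Z\<close>, \<open>g (-\<i>) = Y\<close>, and with \<open>g \<tau>\<close> in the hyperquadric for real \<open>\<tau>\<close>. The function
  \<open>\<langle>f (g \<tau>), f (g (cnj \<tau>))\<rangle>\<close> is holomorphic and equals 1 for real \<open>\<tau>\<close>, hence also at \<open>\<tau> = \<i>\<close>.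
\<close>

lemma hermitian_eq_1_on_segre:
  fixes f :: "'n::finite cspace \<Rightarrow> 'n cspace"
  assumes hol: "holomorphic_map_on f (ball 0 R)" and R: "R > 0"
    and sph: "\<And>Z. Z \<in> ball 0 R \<Longrightarrow> segre P Z Z = 0 \<Longrightarrow> hermitian (f Z) (f Z) = 1"
  shows "\<exists>r>0. r \<le> R \<and> r \<le> 1 \<and> (\<forall>Z\<in>ball 0 r. \<forall>Y\<in>ball 0 r. segre P Z Y = 0 \<longrightarrow> hermitian (f Z) (f Y) = 1)"
proof -
  obtain K where K: "K > 0" "\<And>x y :: complex ^ 'n. cmod (qform P x y) \<le> norm x * norm y * K"
    using bounded_bilinear.pos_bounded[OF bounded_bilinear_qform, of P] by blast
  \<comment> \<open>For \<open>|\<tau>| < 2\<close> the curve below has norm at most \<open>(6 + 9 K) r\<close>; this must stay below \<open>R\<close>.\<close>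
  define r where "r = min 1 R / (7 + 9 * K)"
  have r: "r > 0" "r \<le> 1" "r \<le> R" "(6 + 9 * K) * r < R"
  proof -
    show "r > 0" using R K by (simp add: r_def)
    have a: "r * (7 + 9 * K) = min 1 R" using K by (simp add: r_def)
    have "r * 1 \<le> r * (7 + 9 * K)" using \<open>r > 0\<close> K(1) by (intro mult_left_mono) auto
    then show "r \<le> 1" "r \<le> R" unfolding a by auto
    have "r * (6 + 9 * K) < r * (7 + 9 * K)" using \<open>r > 0\<close> by simp
    then show "(6 + 9 * K) * r < R" unfolding a by (simp add: mult.commute)
  qed
  have "hermitian (f Z) (f Y) = 1" if ZY: "Z \<in> ball 0 r" "Y \<in> ball 0 r" and seg0: "segre P Z Y = 0" for Z Y
  proof -
    \<comment> \<open>\<open>a\<close>, \<open>b\<close>, \<open>s1\<close>, \<open>s2\<close> split the pair \<open>(Z, Y)\<close> into real and imaginary part with respect to the hyperquadric.\<close>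
    define a where "a = (1/2) *s (fst Z + fst Y)"
    define b where "b = (1/(2*\<i>)) *s (fst Z - fst Y)"
    define s where "s = (snd Z + cnj (snd Y)) / 2"
    define s1 where "s1 = complex_of_real (Re s)"
    define s2 where "s2 = complex_of_real (Im s)"
    define q0 where "q0 = qform P a a"
    define q1 where "q1 = qform P a b + qform P b a"
    define q2 where "q2 = qform P b b"
    have real: "cnj q0 = q0" "cnj q1 = q1" "cnj q2 = q2" "cnj s1 = s1" "cnj s2 = s2"
      by (simp_all add: q0_def q1_def q2_def s1_def s2_def qform_cnj)
    have s: "s = s1 + \<i> * s2" unfolding s1_def s2_def by (rule complex_eq)
    define g where "g \<tau> = (a, s1 + \<i> * q0) + cscale \<tau> (b, s2 + \<i> * q1) + cscale (\<tau>\<^sup>2) (0, \<i> * q2)" for \<tau>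
    have zy: "a + \<i> *s b = fst Z" "a + (-\<i>) *s b = fst Y"
      by (simp_all add: a_def b_def vec_eq_iff field_simps)
    have qzy: "qform P (fst Z) (fst Y) = q0 + \<i> * q1 - q2"
      unfolding zy[symmetric] qform_add qform_scale by (simp add: q0_def q1_def q2_def algebra_simps)
    have w: "snd Z = s + \<i> * qform P (fst Z) (fst Y)" "cnj (snd Y) = s - \<i> * qform P (fst Z) (fst Y)"
      using seg0 by (simp_all add: s_def segre_def field_simps)
    have "g \<i> = Z"
      using zy(1) w(1) by (simp add: prod_eq_iff g_def qzy s algebra_simps)
    have "snd Y = cnj s + \<i> * cnj (q0 + \<i> * q1 - q2)"
      using arg_cong[OF w(2), of cnj] by (simp add: qzy)
    then have "g (-\<i>) = Y"
      using zy(2) by (simp add: prod_eq_iff g_def s real algebra_simps)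
    have quadric: "segre P (g \<tau>) (g \<tau>) = 0" if "cnj \<tau> = \<tau>" for \<tau>
      by (simp add: segre_def g_def qform_add qform_scale real that)
         (simp add: q0_def q1_def q2_def power2_eq_square algebra_simps)
    have nz: "norm (fst Z) \<le> r" "norm (fst Y) \<le> r" "norm (snd Z) \<le> r" "norm (snd Y) \<le> r"
      using ZY norm_fst_le[of "fst Z" "snd Z"] norm_fst_le[of "fst Y" "snd Y"]
        norm_snd_le[of "snd Z" "fst Z"] norm_snd_le[of "snd Y" "fst Y"]
      by (auto simp: dist_norm)
    \<comment> \<open>Bounds that keep the curve inside the ball.\<close>
    have na: "norm a \<le> r"
      unfolding a_def norm_smult using norm_triangle_ineq[of "fst Z" "fst Y"] nz by (simp add: norm_divide)
    have nb: "norm b \<le> r"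
      unfolding b_def norm_smult using norm_triangle_ineq4[of "fst Z" "fst Y"] nz
      by (simp add: norm_divide norm_mult)
    have ns: "cmod s \<le> r"
      unfolding s_def using norm_triangle_ineq[of "snd Z" "cnj (snd Y)"] nz by (simp add: norm_divide)
    have ns1: "cmod s1 \<le> r" "cmod s2 \<le> r"
      using abs_Re_le_cmod[of s] abs_Im_le_cmod[of s] ns by (simp_all add: s1_def s2_def)
    have Kq: "cmod (qform P x y) \<le> K * r" if "norm x \<le> r" "norm y \<le> r" for x y
    proof -
      have "norm x * norm y \<le> r * 1" using that r by (intro mult_mono) auto
      then have "norm x * norm y * K \<le> r * 1 * K" using K(1) by (intro mult_right_mono) auto
      then show ?thesis using K(2)[of x y] by (simp add: mult.commute)
    qed
    have nq: "cmod q0 \<le> K * r" "cmod q2 \<le> K * r" "cmod q1 \<le> 2 * (K * r)"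
      using Kq[OF na na] Kq[OF nb nb] Kq[OF na nb] Kq[OF nb na]
        norm_triangle_ineq[of "qform P a b" "qform P b a"]
      by (simp_all add: q0_def q1_def q2_def)
    have inball: "g \<tau> \<in> ball 0 R" if "cmod \<tau> < 2" for \<tau>
    proof -
      have n0: "norm (a, s1 + \<i> * q0) \<le> r + (r + K * r)"
        using norm_Pair_le[of a "s1 + \<i> * q0"] norm_triangle_ineq[of s1 "\<i> * q0"] na ns1 nq
        by (simp add: norm_mult)
      have n1: "norm (b, s2 + \<i> * q1) \<le> r + (r + 2 * (K * r))"
        using norm_Pair_le[of b "s2 + \<i> * q1"] norm_triangle_ineq[of s2 "\<i> * q1"] nb ns1 nq
        by (simp add: norm_mult)
      have n2: "norm (0 :: complex^'n, \<i> * q2) \<le> K * r"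
        using nq by (simp add: norm_mult norm_Pair)
      have t2: "(cmod \<tau>)\<^sup>2 \<le> 4" using power_mono[of "cmod \<tau>" 2 2] that by simp
      have "norm (g \<tau>) \<le> norm (a, s1 + \<i> * q0) + norm (cscale \<tau> (b, s2 + \<i> * q1))
          + norm (cscale (\<tau>\<^sup>2) (0 :: complex^'n, \<i> * q2))"
        unfolding g_def by (meson norm_triangle_le norm_triangle_ineq add_mono order_refl)
      also have "\<dots> \<le> (r + (r + K * r)) + 2 * (r + (r + 2 * (K * r))) + 4 * (K * r)"
        unfolding norm_cscale norm_power
        using n0 mult_mono[OF less_imp_le[OF that] n1] mult_mono[OF t2 n2] by simp
      also have "\<dots> = (6 + 9 * K) * r" by (simp add: algebra_simps)
      finally show ?thesis using r by simp
    qed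
    have g': "(g has_derivative (\<lambda>c. cscale c ((b, s2 + \<i> * q1) + cscale (2 * \<tau>) (0, \<i> * q2)))) (at \<tau>)" for \<tau>
      unfolding g_def power2_eq_square
      by (auto intro!: derivative_eq_intros simp: cscale_alg algebra_simps)
    have hol1: "(\<lambda>\<tau>. hermitian (f (g \<tau>)) e) holomorphic_on ball 0 2" for e
      by (rule holomorphic_along_curve[OF hol _ g']) (use inball in auto)
    have hol2: "(\<lambda>\<tau>. cnj (hermitian (f (g (cnj \<tau>))) e)) holomorphic_on ball 0 2" for e
    proof -
      have "cnj ` ball 0 2 \<subseteq> ball 0 2" by auto
      then have "(cnj \<circ> (\<lambda>\<tau>. hermitian (f (g \<tau>)) e) \<circ> cnj) holomorphic_on ball 0 2"
        by (intro holomorphic_on_compose_cnj_cnj holomorphic_on_subset[OF hol1]) auto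
      then show ?thesis by (simp add: o_def)
    qed
    \<comment> \<open>The pairing is a sum of products of \<open>F \<tau>\<close> and \<open>cnj (F (cnj \<tau>))\<close> with \<open>F\<close> holomorphic.\<close>
    have "(\<lambda>\<tau>. (\<Sum>i\<in>UNIV. fst (f (g \<tau>)) $ i * cnj (fst (f (g (cnj \<tau>))) $ i))
          + snd (f (g \<tau>)) * cnj (snd (f (g (cnj \<tau>)))) - 1) holomorphic_on ball 0 2"
      using hol1 hol2 unfolding hermitian_axis[symmetric] by (intro holomorphic_intros) auto
    then have holh: "(\<lambda>\<tau>. hermitian (f (g \<tau>)) (f (g (cnj \<tau>))) - 1) holomorphic_on ball 0 2"
      by (simp add: hermitian_def)
    have "hermitian (f (g \<i>)) (f (g (cnj \<i>))) - 1 = 0"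
    proof (rule analytic_continuation[OF holh, where U = "complex_of_real ` {-1<..<1}" and \<xi> = 0])
      show "complex_of_real ` {-1<..<1} \<subseteq> ball 0 2" by auto
      show "0 islimpt complex_of_real ` {- 1<..<1}"
        unfolding islimpt_approachable
      proof (intro allI impI)
        fix e :: real assume "e > 0"
        then have "complex_of_real (min (1/2) (e/2)) \<in> complex_of_real ` {- 1<..<1}" by auto
        with \<open>e > 0\<close> show "\<exists>x'\<in>complex_of_real ` {- 1<..<1}. x' \<noteq> 0 \<and> dist x' 0 < e"
          by (intro bexI[of _ "complex_of_real (min (1/2) (e/2))"]) (auto simp: min_def)
      qed
      show "hermitian (f (g z)) (f (g (cnj z))) - 1 = 0" if "z \<in> complex_of_real ` {- 1<..<1}" for z
      proof -
        have "cnj z = z" "cmod z < 2" using that by auto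
        then show ?thesis using sph[OF inball quadric, of z] by simp
      qed
    qed auto
    then show ?thesis using \<open>g \<i> = Z\<close> \<open>g (-\<i>) = Y\<close> by simp
  qed
  then show ?thesis using r by blast
qed

section \<open>Factorisation along a Segre variety\<close>

text \<open>
  Minus the derivative of \<open>segre P Z\<close> in direction \<open>u\<close>; it is the same at every point.
\<close>

definition segre_deriv :: "'n::finite set \<Rightarrow> 'n cspace \<Rightarrow> 'n cspace \<Rightarrow> complex" where
  "segre_deriv P Z u = cnj (snd u) + 2 * \<i> * qform P (fst Z) (fst u)"

lemma segre_add_right: "segre P Z (Y + u) = segre P Z Y - segre_deriv P Z u"
  by (simp add: segre_def segre_deriv_def qform_add algebra_simps)

lemma segre_deriv_cscale: "segre_deriv P Z (cscale c u) = cnj c * segre_deriv P Z u"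
  by (simp add: segre_deriv_def qform_scale algebra_simps)

lemma complex_affine_segre_deriv: "complex_affine (\<lambda>Z. segre_deriv P Z u)"
  by (rule complex_affineI) (simp_all add: segre_deriv_def qform_add qform_scale algebra_simps)

lemma segre_has_derivative: "(segre P Z has_derivative (\<lambda>u. - segre_deriv P Z u)) (at Y)"
proof -
  have "((\<lambda>Y. snd Z - cnj (snd Y) - 2 * \<i> * qform P (fst Z) (fst Y)) has_derivative
      (\<lambda>u. 0 - cnj (snd u) - (2 * \<i> * (qform P (fst Z) (fst u) + qform P 0 (fst Y))))) (at Y)"
    by (auto intro!: derivative_eq_intros)
  then show ?thesis
    unfolding segre_def[abs_def] segre_deriv_def by (simp add: algebra_simps)
qed

lemma qform_axis: "qform P (axis k c) y = (if k \<in> P then 1 else - 1) * (c * cnj (y $ k))"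
  "qform P y (axis k c) = (if k \<in> P then 1 else - 1) * (y $ k * cnj c)"
proof -
  have "(\<Sum>i\<in>UNIV. (if i \<in> P then 1 else - 1) * (axis k c $ i * cnj (y $ i)))
     = (\<Sum>i\<in>UNIV. if i = k then (if k \<in> P then 1 else - 1) * (c * cnj (y $ k)) else 0)"
    by (intro sum.cong) (auto simp: axis_def)
  then show "qform P (axis k c) y = (if k \<in> P then 1 else - 1) * (c * cnj (y $ k))"
    by (simp add: qform_def)
  have "(\<Sum>i\<in>UNIV. (if i \<in> P then 1 else - 1) * (y $ i * cnj (axis k c $ i)))
     = (\<Sum>i\<in>UNIV. if i = k then (if k \<in> P then 1 else - 1) * (y $ k * cnj c) else 0)"
    by (intro sum.cong) (auto simp: axis_def)
  then show "qform P y (axis k c) = (if k \<in> P then 1 else - 1) * (y $ k * cnj c)"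
    by (simp add: qform_def)
qed

lemma qform_nondegenerate:
  assumes "d \<noteq> 0" shows "\<exists>a. qform P a d \<noteq> 0"
proof -
  obtain k where "d $ k \<noteq> 0" using assms by (auto simp: vec_eq_iff)
  then show ?thesis by (intro exI[of _ "axis k 1"]) (simp add: qform_axis)
qed

text \<open>
  Surjectivity of the derivative is the form in which local invertibility of \<open>f\<close> enters: every vector
  is the image of some direction.
\<close>

definition regular_on :: "('n::finite cspace \<Rightarrow> 'n cspace) \<Rightarrow> 'n cspace set \<Rightarrow> bool" where
  "regular_on f S \<longleftrightarrow>
     open S \<and>
     (\<forall>x\<in>S. \<exists>D. (f has_derivative D) (at x) \<and> (\<forall>c v. D (cscale c v) = cscale c (D v)) \<and> surj D)"

lemma regular_onD:
  assumes "regular_on f S" "x \<in> S"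
  obtains D where "(f has_derivative D) (at x)" "\<forall>c v. D (cscale c v) = cscale c (D v)" "surj D"
    "linear D"
  using assms has_derivative_linear unfolding regular_on_def by blast

lemma regular_on_holomorphic: "regular_on f S \<Longrightarrow> holomorphic_map_on f S"
  unfolding regular_on_def holomorphic_map_on_def by blast

lemma regular_on_subset: "regular_on f S \<Longrightarrow> open T \<Longrightarrow> T \<subseteq> S \<Longrightarrow> regular_on f T"
  unfolding regular_on_def by blast

lemma derivative_of_locally_zero:
  assumes "(f has_derivative D) (at x)" "open S" "x \<in> S" "\<And>y. y \<in> S \<Longrightarrow> f y = c"
  shows "D u = 0"
proof -
  have "((\<lambda>y. c) has_derivative D) (at x)"
    by (rule has_derivative_transform_within_open[OF assms(1,2,3)]) (rule assms(4))
  from has_derivative_unique[OF this has_derivative_const] show ?thesis by simp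
qed

lemma hermitian_eq_0_on_range:
  assumes "surj D" "\<And>u. hermitian x (D u) = 0" shows "x = 0"
proof (rule hermitian_eq_0)
  fix u
  obtain v where "u = D v" using surjD[OF assms(1)] by blast
  then show "hermitian x u = 0" using assms(2) by simp
qed

text \<open>
  The point \<open>a\<close> would be orthogonal to the range of a surjective derivative, hence \<open>0\<close>.
\<close>

lemma hermitian_not_locally_one:
  assumes f: "regular_on f S" and T: "open T" "T \<noteq> {}" "T \<subseteq> S" "\<And>Y. Y \<in> T \<Longrightarrow> hermitian a (f Y) = 1"
  shows False
proof -
  obtain Y where Y: "Y \<in> T" using T by blast
  then have "Y \<in> S" using T by blast
  obtain D where D: "(f has_derivative D) (at Y)" "\<forall>c v. D (cscale c v) = cscale c (D v)" "surj D" "linear D"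
    by (rule regular_onD[OF f \<open>Y \<in> S\<close>])
  have "((\<lambda>Y. hermitian a (f Y)) has_derivative (\<lambda>u. hermitian a (D u) + hermitian 0 (f Y))) (at Y)"
    by (intro derivative_intros D)
  from derivative_of_locally_zero[OF this T(1) Y T(4)]
  have "hermitian a (D u) = 0" for u by simp
  then have "a = 0" by (rule hermitian_eq_0_on_range[OF D(3)])
  then show False using T(4)[OF Y] by simp
qed

text \<open>
  If \<open>u\<close> is tangent to the set of \<open>Y'\<close> with \<open>segre P Z Y' = 0\<close>, then \<open>\<langle>f Z, f Y'\<rangle>\<close> is constantly 1 in
  direction \<open>u\<close>, so both sides vanish. The general case follows because the tangent directions have
  codimension 1 and \<open>(0, 1)\<close> is transversal to them.
\<close>

lemma hermitian_derivative_on_segre: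
  assumes D: "(f has_derivative D) (at Y)" "\<And>c v. D (cscale c v) = cscale c (D v)"
    and S: "open S" "Y \<in> S" "segre P Z Y = 0"
    and pol: "\<And>Y'. Y' \<in> S \<Longrightarrow> segre P Z Y' = 0 \<Longrightarrow> hermitian (f Z) (f Y') = 1"
  shows "hermitian (f Z) (D u) = segre_deriv P Z u * hermitian (f Z) (D (0, 1))"
proof -
  have linD: "linear D" using D(1) by (rule has_derivative_linear)
  have tangent: "hermitian (f Z) (D v) = 0" if v: "segre_deriv P Z v = 0" for v
  proof -
    have g: "((\<lambda>t. Y + t *\<^sub>R v) has_derivative (\<lambda>t. t *\<^sub>R v)) (at 0)"
      by (auto intro!: derivative_eq_intros)
    have "((\<lambda>t. f (Y + t *\<^sub>R v)) has_derivative (\<lambda>t. D (t *\<^sub>R v))) (at 0)"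
      using has_derivative_compose[OF g, of f D] D(1) by simp
    then have d: "((\<lambda>t. hermitian (f Z) (f (Y + t *\<^sub>R v))) has_derivative
        (\<lambda>t. hermitian (f Z) (D (t *\<^sub>R v)) + hermitian 0 (f (Y + 0 *\<^sub>R v)))) (at 0)"
      by (intro derivative_intros)
    have "continuous_on UNIV (\<lambda>t. Y + t *\<^sub>R v)" by (intro continuous_intros)
    then have opn: "open ((\<lambda>t. Y + t *\<^sub>R v) -` S)" using S by (simp add: open_vimage)
    have "segre P Z (Y + t *\<^sub>R v) = 0" for t
      using v S(3) by (simp add: segre_add_right scaleR_cscale segre_deriv_cscale)
    then have "hermitian (f Z) (D (1 *\<^sub>R v)) + hermitian 0 (f (Y + 0 *\<^sub>R v)) = 0"
      using pol S by (intro derivative_of_locally_zero[OF d opn, of 1]) auto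
    then show ?thesis by simp
  qed
  define s where "s = cnj (segre_deriv P Z u)"
  have "segre_deriv P Z (u - cscale s (0, 1)) = 0"
    by (simp add: segre_deriv_def s_def qform_diff)
  from tangent[OF this] have "hermitian (f Z) (D u - cscale s (D (0, 1))) = 0"
    by (simp only: linear_diff[OF linD] D(2))
  then show ?thesis by (simp add: hermitian_diff hermitian_scale s_def)
qed

text \<open>
  Writing \<open>f Y' - f Y\<close> as a value of the derivative of \<open>f\<close> at \<open>Y\<close> turns
  \<open>\<langle>f Z, f Y'\<rangle> - 1 = \<langle>f Z, f Y' - f Y\<rangle>\<close> into \<open>h Z\<close> times an affine function of \<open>Z\<close>. On the Segre
  variety of \<open>Y\<close> this function vanishes where \<open>segre P Z Y'\<close> does, so it is a multiple of
  \<open>segre P Z Y'\<close>, provided that the two Segre varieties meet within \<open>S\<close> and are not parallel.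
\<close>

lemma hermitian_factor_on_segre:
  fixes f :: "'n::finite cspace \<Rightarrow> 'n cspace"
  assumes f: "regular_on f S"
    and pol: "\<And>Z Y. Z \<in> S \<Longrightarrow> Y \<in> S \<Longrightarrow> segre P Z Y = 0 \<Longrightarrow> hermitian (f Z) (f Y) = 1"
    and Y: "Y \<in> S"
  shows "\<exists>h. \<forall>Y'\<in>S. \<forall>Z0\<in>S. segre P Z0 Y = 0 \<longrightarrow> segre P Z0 Y' = 0 \<longrightarrow> fst Y \<noteq> fst Y' \<longrightarrow>
    (\<exists>m. \<forall>Z\<in>S. segre P Z Y = 0 \<longrightarrow> hermitian (f Z) (f Y') - 1 = h Z * m * segre P Z Y')"
proof -
  obtain D where D: "(f has_derivative D) (at Y)" "\<forall>c v. D (cscale c v) = cscale c (D v)" "surj D" "linear D"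
    by (rule regular_onD[OF f Y])
  have oS: "open S" using f by (simp add: regular_on_def)
  define h where "h Z = hermitian (f Z) (D (0, 1))" for Z
  have fo: "hermitian (f Z) (D u) = segre_deriv P Z u * h Z" if "Z \<in> S" "segre P Z Y = 0" for Z u
    unfolding h_def by (rule hermitian_derivative_on_segre[OF D(1) D(2)[rule_format] oS Y that(2)]) (use pol that in auto)
  have h0: "h Z \<noteq> 0" if Z: "Z \<in> S" "segre P Z Y = 0" for Z
  proof
    assume "h Z = 0"
    then have "hermitian (f Z) (D u) = 0" for u using fo[OF Z] by simp
    then have "f Z = 0" by (rule hermitian_eq_0_on_range[OF D(3)])
    then show False using pol[OF Z(1) Y Z(2)] by simp
  qed
  show ?thesis
  proof (intro exI[of _ h] ballI impI)
    fix Y' Z0 assume Y': "Y' \<in> S" and Z0: "Z0 \<in> S" "segre P Z0 Y = 0" "segre P Z0 Y' = 0"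
      and ne: "fst Y \<noteq> fst Y'"
    obtain q where q: "D q = f Y' - f Y" using D(3) by (metis surjD)
    have c: "hermitian (f Z) (f Y') - 1 = segre_deriv P Z q * h Z" if "Z \<in> S" "segre P Z Y = 0" for Z
      using fo[OF that, of q] pol[OF that(1) Y that(2)] by (simp add: q hermitian_diff)
    \<comment> \<open>Projection to the Segre variety of \<open>Y\<close> along the last coordinate: an affine function on the whole space represents the restriction.\<close>
    define g where "g Z = (fst Z, cnj (snd Y) + 2 * \<i> * qform P (fst Z) (fst Y))" for Z :: "'n cspace"
    have gY: "segre P (g Z) Y = 0" for Z by (simp add: g_def segre_def)
    have gid: "g Z = Z" if "segre P Z Y = 0" for Z
      using that by (simp add: g_def segre_def prod_eq_iff algebra_simps)
    have dg: "segre_deriv P (g Z) q = segre_deriv P Z q" for Z by (simp add: g_def segre_deriv_def)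
    have segg: "segre P (g Z) Y' = cnj (snd Y) - cnj (snd Y') + 2 * \<i> * qform P (fst Z) (fst Y - fst Y')" for Z
      by (simp add: g_def segre_def qform_diff algebra_simps)
    have "\<exists>m. \<forall>Z. segre_deriv P Z q = m * segre P (g Z) Y'"
    proof -
      have "continuous_on UNIV g" unfolding g_def by (intro continuous_intros)
      then have opn: "open (g -` S)" using oS by (simp add: open_vimage)
      have aff: "complex_affine (\<lambda>Z. segre P (g Z) Y')"
        unfolding segg by (rule complex_affineI) (simp_all add: qform_add qform_scale algebra_simps)
      obtain a where a: "qform P a (fst Y - fst Y') \<noteq> 0"
        using qform_nondegenerate ne by (metis eq_iff_diff_eq_0)
      show ?thesis
      proof (rule complex_affine_multiple_if_vanishing[OF complex_affine_segre_deriv aff opn])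
        show "Z0 \<in> g -` S" "segre P (g Z0) Y' = 0" using Z0 gid by auto
        show "segre_deriv P z q = 0" if z: "z \<in> g -` S" "segre P (g z) Y' = 0" for z
        proof -
          have "segre_deriv P (g z) q * h (g z) = 0" using c[of "g z"] gY pol[of "g z" Y'] z Y' by auto
          then show ?thesis using h0[of "g z"] gY z by (simp add: dg)
        qed
        show "segre P (g (a, 0)) Y' \<noteq> segre P (g 0) Y'" using a by (simp add: segg)
      qed
    qed
    then obtain m where "\<And>Z. segre_deriv P Z q = m * segre P (g Z) Y'" by blast
    then have "\<forall>Z\<in>S. segre P Z Y = 0 \<longrightarrow> hermitian (f Z) (f Y') - 1 = h Z * m * segre P Z Y'"
      using c gid by (simp add: mult.commute mult.left_commute)
    then show "\<exists>m. \<forall>Z\<in>S. segre P Z Y = 0 \<longrightarrow> hermitian (f Z) (f Y') - 1 = h Z * m * segre P Z Y'" by blast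
  qed
qed

section \<open>Cross ratios and the affine denominator\<close>

lemma norm_axis_complex: "norm (axis k c :: complex ^ 'n::finite) = cmod c"
proof -
  have "axis k c = c *s axis k 1" by (simp add: vec_eq_iff axis_def)
  then show ?thesis by (simp add: norm_smult norm_axis_1)
qed

lemma axis_same: "axis k c $ k = c"
  by (simp add: axis_def)

text \<open>
  A sufficient condition for the Segre varieties of \<open>(axis k \<kappa>, 0)\<close> and \<open>Y'\<close> to meet near \<open>0\<close>: the two are
  transversal because \<open>fst Y'\<close> is large compared with \<open>\<kappa>\<close>, while the offset \<open>snd Y'\<close> is small.
\<close>

lemma segre_varieties_meet_in_ball:
  fixes P :: "'n::finite set" and k :: 'n
  assumes r: "0 < r" "r \<le> 1" and \<kappa>: "cmod \<kappa> < r / 16"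
    and Y': "r / 8 < cmod (fst Y' $ k)" "cmod (snd Y') < r\<^sup>2 / 16"
  shows "\<exists>Z0\<in>ball 0 r. segre P Z0 (axis k \<kappa>, 0) = 0 \<and> segre P Z0 Y' = 0"
proof -
  define sg :: complex where "sg = (if k \<in> P then 1 else - 1)"
  have sg: "sg \<noteq> 0" "cmod sg = 1" "sg * sg = 1" by (auto simp: sg_def)
  define d where "d = \<kappa> - fst Y' $ k"
  \<comment> \<open>The solution of the two equations on the line spanned by \<open>axis k 1\<close>.\<close>
  define t where "t = cnj (snd Y') / (2 * \<i> * sg * cnj d)"
  have nd: "r / 16 < cmod d"
    using norm_triangle_ineq2[of "fst Y' $ k" \<kappa>] Y'(1) \<kappa> by (simp add: d_def norm_minus_commute)
  then have d0: "d \<noteq> 0" using r by auto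
  have t: "2 * \<i> * (sg * (t * cnj d)) = cnj (snd Y')"
    using d0 sg by (simp add: t_def field_simps)
  have tn: "cmod t < r / 2"
  proof -
    have "cmod t = cmod (snd Y') / (2 * cmod d)" by (simp add: t_def norm_divide norm_mult sg)
    also have "\<dots> < (r\<^sup>2 / 16) / (2 * (r / 16))"
      using Y'(2) nd r by (intro frac_less) auto
    also have "\<dots> = r / 2" using r by (simp add: power2_eq_square)
    finally show ?thesis .
  qed
  define Z0 where "Z0 = (axis k t, 2 * \<i> * (sg * (t * cnj \<kappa>)))"
  have "norm Z0 \<le> cmod t + 2 * (cmod t * cmod \<kappa>)"
    using norm_Pair_le[of "axis k t" "2 * \<i> * (sg * (t * cnj \<kappa>))"]
    by (simp add: Z0_def norm_axis_complex norm_mult sg)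
  also have "\<dots> \<le> r / 2 + 2 * (r / 2 * (1 / 16))"
    using tn \<kappa> r by (intro add_mono mult_left_mono mult_mono) auto
  also have "\<dots> < r" using r by simp
  finally have "Z0 \<in> ball 0 r" by simp
  moreover have "segre P Z0 (axis k \<kappa>, 0) = 0"
    by (simp add: segre_def Z0_def qform_axis(1) sg_def axis_same)
  moreover have "segre P Z0 Y' = 2 * \<i> * (sg * (t * cnj d)) - cnj (snd Y')"
    by (simp add: segre_def Z0_def qform_axis(1) sg_def d_def algebra_simps)
  ultimately show ?thesis using t by auto
qed

text \<open>
  There is \<open>Y = (axis k \<kappa>, 0)\<close> whose Segre variety contains both \<open>0\<close> and \<open>Z\<close>. On it the factorisation
  separates the variables, so the quotient of \<open>\<langle>f Z, f Y'\<rangle> - 1\<close> by \<open>segre P Z Y'\<close> at \<open>Y1\<close> and at \<open>Y2\<close> has the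
  same ratio for \<open>Z\<close> as for \<open>0\<close>. The identity is stated without denominators.
\<close>

lemma cross_ratio_identity:
  fixes f :: "'n::finite cspace \<Rightarrow> 'n cspace"
  assumes f: "regular_on f (ball 0 r)" and r: "0 < r" "r \<le> 1"
    and pol: "\<And>Z Y. Z \<in> ball 0 r \<Longrightarrow> Y \<in> ball 0 r \<Longrightarrow> segre P Z Y = 0 \<Longrightarrow> hermitian (f Z) (f Y) = 1"
    and Z: "Z \<in> ball 0 r" "cmod (snd Z) < (r / 8) * cmod (fst Z $ k)"
    and Y1: "Y1 \<in> ball 0 r" "r / 8 < cmod (fst Y1 $ k)" "cmod (snd Y1) < r\<^sup>2 / 16"
    and Y2: "Y2 \<in> ball 0 r" "r / 8 < cmod (fst Y2 $ k)" "cmod (snd Y2) < r\<^sup>2 / 16"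
  shows "(hermitian (f Z) (f Y2) - 1) * (hermitian (f 0) (f Y1) - 1) * (segre P Z Y1 * segre P 0 Y2) =
         (hermitian (f Z) (f Y1) - 1) * (hermitian (f 0) (f Y2) - 1) * (segre P Z Y2 * segre P 0 Y1)"
proof -
  define sg :: complex where "sg = (if k \<in> P then 1 else - 1)"
  have sg: "sg \<noteq> 0" "cmod sg = 1" "cnj sg = sg" by (auto simp: sg_def)
  define z where "z = fst Z $ k"
  have z0: "z \<noteq> 0" using Z(2) norm_ge_zero[of "snd Z"] by (auto simp: z_def)
  \<comment> \<open>Chosen so that \<open>segre P Z (axis k \<kappa>, 0) = 0\<close>; the equation at \<open>0\<close> holds for every \<open>\<kappa>\<close>.\<close>
  define \<kappa> where "\<kappa> = cnj (snd Z / (2 * \<i> * sg * z))"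
  have "cmod \<kappa> = cmod (snd Z) / (2 * cmod z)"
    by (simp add: \<kappa>_def norm_divide norm_mult sg)
  also have "\<dots> < r / 16"
    using Z(2) z0 by (simp add: z_def field_simps)
  finally have \<kappa>: "cmod \<kappa> < r / 16" .
  define Y :: "'n cspace" where "Y = (axis k \<kappa>, 0)"
  have Yb: "Y \<in> ball 0 r" using \<kappa> r by (simp add: Y_def norm_Pair norm_axis_complex)
  have segZ: "segre P Z Y = 0"
    unfolding segre_def Y_def fst_conv qform_axis(2) sg_def[symmetric] z_def[symmetric]
    using z0 sg by (simp add: \<kappa>_def)
  have seg0: "segre P 0 Y = 0" by (simp add: segre_def Y_def)
  obtain h where h: "\<forall>Y'\<in>ball 0 r. \<forall>Z0\<in>ball 0 r. segre P Z0 Y = 0 \<longrightarrow> segre P Z0 Y' = 0 \<longrightarrow> fst Y \<noteq> fst Y' \<longrightarrow>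
    (\<exists>m. \<forall>Z\<in>ball 0 r. segre P Z Y = 0 \<longrightarrow> hermitian (f Z) (f Y') - 1 = h Z * m * segre P Z Y')"
    using hermitian_factor_on_segre[OF f pol Yb] by blast
  have fac: "\<exists>m. hermitian (f Z) (f Y') - 1 = h Z * m * segre P Z Y' \<and> hermitian (f 0) (f Y') - 1 = h 0 * m * segre P 0 Y'"
    if Y': "Y' \<in> ball 0 r" "r / 8 < cmod (fst Y' $ k)" "cmod (snd Y') < r\<^sup>2 / 16" for Y'
  proof -
    obtain Z0 where Z0: "Z0 \<in> ball 0 r" "segre P Z0 Y = 0" "segre P Z0 Y' = 0"
      using segre_varieties_meet_in_ball[OF r \<kappa> Y'(2,3), of P] unfolding Y_def by blast
    have "fst Y \<noteq> fst Y'"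
    proof
      assume "fst Y = fst Y'"
      then have "fst Y' $ k = \<kappa>" by (metis Y_def fst_conv axis_same)
      then show False using \<kappa> Y'(2) r by simp
    qed
    then obtain m where "\<forall>Z\<in>ball 0 r. segre P Z Y = 0 \<longrightarrow> hermitian (f Z) (f Y') - 1 = h Z * m * segre P Z Y'"
      using h Y'(1) Z0 by blast
    then show ?thesis using Z(1) segZ seg0 r(1) by (intro exI[of _ m]) simp
  qed
  obtain m1 where "hermitian (f Z) (f Y1) - 1 = h Z * m1 * segre P Z Y1" "hermitian (f 0) (f Y1) - 1 = h 0 * m1 * segre P 0 Y1"
    using fac[OF Y1] by blast
  moreover obtain m2 where "hermitian (f Z) (f Y2) - 1 = h Z * m2 * segre P Z Y2" "hermitian (f 0) (f Y2) - 1 = h 0 * m2 * segre P 0 Y2"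
    using fac[OF Y2] by blast
  ultimately show ?thesis by (simp only: ac_simps)
qed

text \<open>
  Open sets in which \<open>Z\<close> and \<open>Y\<close> may vary freely in the cross ratio identity, with a base point \<open>Ys\<close> at
  which the denominators used later are nonzero.
\<close>

lemma cross_ratio_region:
  fixes f :: "'n::finite cspace \<Rightarrow> 'n cspace"
  assumes f: "regular_on f (ball 0 r)" and r: "0 < r" "r \<le> 1"
    and pol: "\<And>Z Y. Z \<in> ball 0 r \<Longrightarrow> Y \<in> ball 0 r \<Longrightarrow> segre P Z Y = 0 \<Longrightarrow> hermitian (f Z) (f Y) = 1"
  obtains Ys SY SZ where "open SY" "Ys \<in> SY" "SY \<subseteq> ball 0 r" "open SZ" "SZ \<noteq> {}" "SZ \<subseteq> ball 0 r"
    "segre P 0 Ys \<noteq> 0" "hermitian (f 0) (f Ys) - 1 \<noteq> 0"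
    "\<forall>Z\<in>SZ. segre P Z Ys \<noteq> 0 \<and> hermitian (f Z) (f Ys) - 1 \<noteq> 0"
    "\<forall>Z\<in>SZ. \<forall>Y\<in>SY. (hermitian (f Z) (f Y) - 1) * (hermitian (f 0) (f Ys) - 1) * (segre P Z Ys * segre P 0 Y) =
         (hermitian (f Z) (f Ys) - 1) * (hermitian (f 0) (f Y) - 1) * (segre P Z Y * segre P 0 Ys)"
proof -
  fix k :: 'n
  have contf: "continuous_on (ball 0 r) f"
    using f by (intro holomorphic_map_on_continuous regular_on_holomorphic)
  define SY where "SY = ball 0 r \<inter> {Y :: 'n cspace. r / 8 < cmod (fst Y $ k)} \<inter> {Y. cmod (snd Y) < r\<^sup>2 / 16}"
  have oSY: "open SY" unfolding SY_def
    by (intro open_Int open_ball open_Collect_less continuous_intros)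
  have "(axis k (of_real (r / 4)), 0) \<in> SY"
    using r by (simp add: SY_def norm_Pair norm_axis_complex axis_same)
  then have neSY: "SY \<noteq> {}" by blast
  obtain Ys where Ys: "Ys \<in> SY" "hermitian (f 0) (f Ys) - 1 \<noteq> 0"
  proof (rule ccontr)
    assume "\<not> thesis"
    then have "\<And>Y. Y \<in> SY \<Longrightarrow> hermitian (f 0) (f Y) = 1" using that by fastforce
    then show False by (rule hermitian_not_locally_one[OF f oSY neSY, rotated]) (auto simp: SY_def)
  qed
  have seg0: "segre P 0 Ys \<noteq> 0"
  proof
    assume "segre P 0 Ys = 0"
    then have "hermitian (f 0) (f Ys) = 1" using pol[of 0 Ys] Ys(1) r by (simp add: SY_def)
    then show False using Ys(2) by simp
  qed
  define F where "F Z = segre P Z Ys * (hermitian (f Z) (f Ys) - 1)" for Z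
  have "continuous_on (ball 0 r) F"
    unfolding F_def by (intro continuous_intros contf)
  then have oN: "open (ball 0 r \<inter> F -` (- {0}))"
    by (intro continuous_open_preimage) auto
  have "0 \<in> ball 0 r \<inter> F -` (- {0})" using r seg0 Ys(2) by (simp add: F_def)
  then obtain e where e: "e > 0" "ball 0 e \<subseteq> ball 0 r \<inter> F -` (- {0})"
    using oN by (meson open_contains_ball)
  \<comment> \<open>The point \<open>0\<close> itself is excluded by the last condition but is a limit of the points \<open>(axis k t, 0)\<close>, which satisfy it.\<close>
  define SZ where "SZ = ball 0 e \<inter> {Z :: 'n cspace. cmod (snd Z) < (r / 8) * cmod (fst Z $ k)}"
  have oSZ: "open SZ" unfolding SZ_def
    by (intro open_Int open_ball open_Collect_less continuous_intros)
  have "(axis k (of_real (e / 2)), 0) \<in> SZ"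
    using r e(1) by (simp add: SZ_def norm_Pair norm_axis_complex axis_same)
  then have neSZ: "SZ \<noteq> {}" by blast
  have SZ: "SZ \<subseteq> ball 0 r" "\<forall>Z\<in>SZ. segre P Z Ys \<noteq> 0 \<and> hermitian (f Z) (f Ys) - 1 \<noteq> 0"
    using e(2) by (auto simp: SZ_def F_def subset_iff)
  show thesis
  proof (rule that[OF oSY Ys(1) _ oSZ neSZ SZ(1) seg0 Ys(2) SZ(2)])
    show "SY \<subseteq> ball 0 r" by (auto simp: SY_def)
    show "\<forall>Z\<in>SZ. \<forall>Y\<in>SY. (hermitian (f Z) (f Y) - 1) * (hermitian (f 0) (f Ys) - 1) * (segre P Z Ys * segre P 0 Y) =
         (hermitian (f Z) (f Ys) - 1) * (hermitian (f 0) (f Y) - 1) * (segre P Z Y * segre P 0 Ys)"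
    proof (intro ballI)
      fix Z Y assume "Z \<in> SZ" "Y \<in> SY"
      then show "(hermitian (f Z) (f Y) - 1) * (hermitian (f 0) (f Ys) - 1) * (segre P Z Ys * segre P 0 Y) =
         (hermitian (f Z) (f Ys) - 1) * (hermitian (f 0) (f Y) - 1) * (segre P Z Y * segre P 0 Ys)"
        using SZ(1) Ys(1) by (intro cross_ratio_identity[OF f r pol, where k = k]) (auto simp: SY_def SZ_def)
    qed
  qed
qed

lemma complex_affine_map_components:
  assumes "\<And>i. complex_affine (p i)" "complex_affine q"
  shows "complex_affine_map (\<lambda>Z. (\<chi> i. p i Z, q Z))"
  unfolding complex_affine_map_def
  by (auto simp: prod_eq_iff vec_eq_iff complex_affine_plus[OF assms(1)] complex_affine_plus[OF assms(2)]
      complex_affine_cscale[OF assms(1)] complex_affine_cscale[OF assms(2)] algebra_simps)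

text \<open>
  Differentiating the cross ratio identity in \<open>Y\<close> at \<open>Ys\<close> shows that \<open>\<langle>\<sigma>0 Z f Z, D u\<rangle>\<close> is affine in
  \<open>Z\<close> for every direction \<open>u\<close>, where \<open>D\<close> is the derivative of \<open>f\<close> at \<open>Ys\<close>. As \<open>D\<close> is surjective, all
  components of \<open>\<sigma>0 Z f Z\<close> are affine, and then so is \<open>\<sigma>0\<close> itself.
\<close>

lemma linear_fractional_on_open:
  fixes f :: "'n::finite cspace \<Rightarrow> 'n cspace"
  assumes f: "regular_on f (ball 0 r)" and r: "0 < r" "r \<le> 1"
    and pol: "\<And>Z Y. Z \<in> ball 0 r \<Longrightarrow> Y \<in> ball 0 r \<Longrightarrow> segre P Z Y = 0 \<Longrightarrow> hermitian (f Z) (f Y) = 1"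
  obtains p \<sigma> SZ where "complex_affine_map p" "complex_affine \<sigma>" "open SZ" "SZ \<noteq> {}" "SZ \<subseteq> ball 0 r"
    "\<forall>Z\<in>SZ. \<sigma> Z \<noteq> 0 \<and> cscale (\<sigma> Z) (f Z) = p Z"
proof -
  obtain Ys SY SZ where R: "open SY" "Ys \<in> SY" "SY \<subseteq> ball 0 r" "open SZ" "SZ \<noteq> {}" "SZ \<subseteq> ball 0 r"
    "segre P 0 Ys \<noteq> 0" "hermitian (f 0) (f Ys) - 1 \<noteq> 0"
    "\<forall>Z\<in>SZ. segre P Z Ys \<noteq> 0 \<and> hermitian (f Z) (f Ys) - 1 \<noteq> 0"
    "\<forall>Z\<in>SZ. \<forall>Y\<in>SY. (hermitian (f Z) (f Y) - 1) * (hermitian (f 0) (f Ys) - 1) * (segre P Z Ys * segre P 0 Y) =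
         (hermitian (f Z) (f Ys) - 1) * (hermitian (f 0) (f Y) - 1) * (segre P Z Y * segre P 0 Ys)"
    by (rule cross_ratio_region[OF f r pol])
  define Bs where "Bs = segre P 0 Ys"
  define Cs where "Cs = hermitian (f 0) (f Ys) - 1"
  have nz: "Bs \<noteq> 0" "Cs \<noteq> 0" using R(7,8) by (simp_all add: Bs_def Cs_def)
  have "Ys \<in> ball 0 r" using R(2,3) by blast
  obtain D where D: "(f has_derivative D) (at Ys)" "\<forall>c v. D (cscale c v) = cscale c (D v)" "surj D" "linear D"
    by (rule regular_onD[OF f \<open>Ys \<in> ball 0 r\<close>])
  define \<sigma>0 where "\<sigma>0 Z = segre P Z Ys / (hermitian (f Z) (f Ys) - 1)" for Z
  \<comment> \<open>The value of \<open>\<langle>\<sigma>0 Z f Z, D u\<rangle>\<close> read off from the differentiated identity.\<close>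
  define \<Psi> where "\<Psi> u Z = (cnj (snd u) / Bs + hermitian (f 0) (D u) / Cs) * segre P Z Ys - segre_deriv P Z u" for u Z
  have aff\<Psi>: "complex_affine (\<Psi> u)" for u
    unfolding \<Psi>_def[abs_def] by (intro complex_affine_diff complex_affine_cmult complex_affine_segre complex_affine_segre_deriv)
  have main: "\<sigma>0 Z * hermitian (f Z) (D u) = \<Psi> u Z" if Z: "Z \<in> SZ" for Z u
  proof -
    define s where "s = segre P Z Ys"
    define c where "c = hermitian (f Z) (f Ys) - 1"
    have c: "c \<noteq> 0" using R(9) Z by (simp add: c_def)
    have hd: "((\<lambda>Y. hermitian a (f Y) - 1) has_derivative (\<lambda>u. hermitian a (D u))) (at Ys)" for a
      by (auto intro!: derivative_eq_intros D(1))
    have "((\<lambda>Y. (hermitian (f Z) (f Y) - 1) * Cs * (s * segre P 0 Y)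
             - c * (hermitian (f 0) (f Y) - 1) * (segre P Z Y * Bs)) has_derivative
       (\<lambda>u. hermitian (f Z) (D u) * Cs * (s * Bs) + c * Cs * (s * (- segre_deriv P 0 u))
          - (c * hermitian (f 0) (D u) * (s * Bs) + c * Cs * ((- segre_deriv P Z u) * Bs)))) (at Ys)"
      by (rule derivative_eq_intros hd segre_has_derivative refl)+
        (simp add: fun_eq_iff s_def c_def Bs_def Cs_def algebra_simps)
    from derivative_of_locally_zero[OF this R(1,2), of 0 u]
    have "hermitian (f Z) (D u) * Cs * (s * Bs) + c * Cs * (s * (- segre_deriv P 0 u))
          - (c * hermitian (f 0) (D u) * (s * Bs) + c * Cs * ((- segre_deriv P Z u) * Bs)) = 0"
      using R(10) Z by (simp add: s_def c_def Bs_def Cs_def)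
    moreover have "segre_deriv P 0 u = cnj (snd u)" by (simp add: segre_deriv_def)
    ultimately have "s * hermitian (f Z) (D u) = c * ((cnj (snd u) / Bs + hermitian (f 0) (D u) / Cs) * s - segre_deriv P Z u)"
      using nz by (simp add: field_simps)
    then show ?thesis
      using c by (simp add: \<sigma>0_def \<Psi>_def s_def[symmetric] c_def[symmetric] field_simps)
  qed
  define E where "E = inv D"
  have E: "D (E v) = v" for v unfolding E_def using D(3) by (rule surj_f_inv_f)
  define p where "p Z = (\<chi> i. \<Psi> (E (axis i 1, 0)) Z, \<Psi> (E (0, 1)) Z)" for Z
  \<comment> \<open>From \<open>\<sigma>0 Z (\<langle>f Z, f Ys\<rangle> - 1) = segre P Z Ys\<close>, solved for \<open>\<sigma>0 Z\<close>.\<close>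
  define \<sigma> where "\<sigma> Z = hermitian (p Z) (f Ys) - segre P Z Ys" for Z
  have affp: "complex_affine_map p" unfolding p_def[abs_def] by (intro complex_affine_map_components aff\<Psi>)
  have aff\<sigma>: "complex_affine \<sigma>" unfolding \<sigma>_def[abs_def] by (intro complex_affine_diff complex_affine_hermitian affp complex_affine_segre)
  have pf: "p Z = cscale (\<sigma>0 Z) (f Z)" if "Z \<in> SZ" for Z
    using main[OF that] by (simp add: p_def prod_eq_iff vec_eq_iff E hermitian_axis flip: main[OF that])
  have "\<sigma> Z = \<sigma>0 Z \<and> \<sigma>0 Z \<noteq> 0" if Z: "Z \<in> SZ" for Z
  proof -
    have n: "segre P Z Ys \<noteq> 0" "hermitian (f Z) (f Ys) - 1 \<noteq> 0" using R(9) Z by auto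
    then have "segre P Z Ys = \<sigma>0 Z * (hermitian (f Z) (f Ys) - 1)" by (simp add: \<sigma>0_def)
    then have "\<sigma> Z = \<sigma>0 Z" by (simp add: \<sigma>_def pf[OF Z] hermitian_scale algebra_simps)
    then show ?thesis using n by (simp add: \<sigma>0_def)
  qed
  then have "\<forall>Z\<in>SZ. \<sigma> Z \<noteq> 0 \<and> cscale (\<sigma> Z) (f Z) = p Z" using pf by simp
  then show thesis by (rule that[OF affp aff\<sigma> R(4,5,6)])
qed

section \<open>Rigidity of maps from a hyperquadric to the sphere\<close>

lemma complex_affine_continuous: "complex_affine F \<Longrightarrow> continuous_on S F"
  by (meson complex_affine_has_derivative continuous_at_imp_continuous_on has_derivative_continuous)

text \<open>
  For fixed \<open>Y\<close> the left side is affine in \<open>Z\<close> and vanishes on the Segre variety, hence is \<open>m Y * segre P Z Y\<close>.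
  It is Hermitian whereas \<open>segre P\<close> is skew, so \<open>m Y = - cnj (m Z)\<close> whenever \<open>segre P Z Y \<noteq> 0\<close>, and
  \<open>m\<close> is constant. Symmetry then removes the restriction on \<open>Y\<close>.
\<close>

lemma hermitian_form_proportional_to_segre:
  assumes aff: "complex_affine_map p" "complex_affine \<sigma>" and r: "0 < r"
    and van: "\<And>Z Y. Z \<in> ball 0 r \<Longrightarrow> Y \<in> ball 0 r \<Longrightarrow> segre P Z Y = 0 \<Longrightarrow>
      hermitian (p Z) (p Y) = \<sigma> Z * cnj (\<sigma> Y)"
  shows "\<exists>l. \<forall>Z Y. hermitian (p Z) (p Y) - \<sigma> Z * cnj (\<sigma> Y) = l * segre P Z Y"
proof -
  define H where "H Z Y = hermitian (p Z) (p Y) - \<sigma> Z * cnj (\<sigma> Y)" for Z Y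
  have Hc: "cnj (H Z Y) = H Y Z" for Z Y by (simp add: H_def hermitian_cnj mult.commute)
  have affH: "complex_affine (\<lambda>Z. H Z Y)" for Y
    unfolding H_def mult.commute[of _ "cnj _"] by (intro complex_affine_diff complex_affine_hermitian complex_affine_cmult aff)
  have "\<exists>m. \<forall>Z. H Z Y = m * segre P Z Y" if Y: "Y \<in> ball 0 r" for Y
  proof (rule complex_affine_multiple_if_vanishing[OF affH complex_affine_segre open_ball])
    have "norm (0 :: complex^'a, cnj (snd Y)) \<le> norm Y"
      using norm_snd_le[of "snd Y" "fst Y"] by (simp add: norm_Pair)
    then show "(0, cnj (snd Y)) \<in> ball (0 :: 'a cspace) r" using Y by simp
    show "segre P (0, cnj (snd Y)) Y = 0" by (simp add: segre_def)
    show "H z Y = 0" if "z \<in> ball 0 r" "segre P z Y = 0" for z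
      using van[OF that(1) Y that(2)] by (simp add: H_def)
    show "segre P (0, 1) Y \<noteq> segre P 0 Y" by (simp add: segre_def)
  qed
  then obtain m where m: "\<And>Y Z. Y \<in> ball 0 r \<Longrightarrow> H Z Y = m Y * segre P Z Y" by metis
  have anti: "m Y = - cnj (m Z)" if "Y \<in> ball 0 r" "Z \<in> ball 0 r" "segre P Z Y \<noteq> 0" for Y Z
  proof -
    have "m Y * segre P Z Y = cnj (m Z * segre P Y Z)"
      using m[OF that(1), of Z] m[OF that(2), of Y] Hc[of Y Z] by simp
    then have "m Y * segre P Z Y = (- cnj (m Z)) * segre P Z Y" by (simp add: segre_cnj)
    then show ?thesis using that(3) by (metis mult_right_cancel)
  qed
  have const: "m Y1 = m Y2" if Y: "Y1 \<in> ball 0 r" "Y2 \<in> ball 0 r" for Y1 Y2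
  proof -
    \<comment> \<open>Two values of \<open>m\<close> are compared through a third point that lies on neither Segre variety.\<close>
    have "infinite (ball (0::complex) r)" using uncountable_ball[OF r] uncountable_infinite by blast
    then obtain v where v: "v \<in> ball 0 r" "v \<notin> {cnj (snd Y1), cnj (snd Y2)}"
      by (meson finite.emptyI finite_insert finite_subset subsetI)
    then have "(0, v) \<in> ball (0 :: 'a cspace) r" "segre P (0, v) Y1 \<noteq> 0" "segre P (0, v) Y2 \<noteq> 0"
      by (auto simp: segre_def norm_Pair)
    then show ?thesis using anti Y by metis
  qed
  define l where "l = m 0"
  have l: "H Z Y = l * segre P Z Y" if "Y \<in> ball 0 r" for Z Y
    using m[OF that] const[OF that, of 0] r by (simp add: l_def)
  have "l = - cnj l"
    using anti[of 0 "(0, of_real (r / 2))"] const[of "(0, of_real (r / 2))" 0] r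
    by (simp add: l_def segre_def norm_Pair)
  have all: "H Z Y = l * segre P Z Y" for Z Y
  proof -
    have "H Z Y - l * segre P Z Y = 0"
    proof (rule complex_affine_eq_0[where S = "ball 0 r" and F = "\<lambda>Z. H Z Y - l * segre P Z Y"])
      show "complex_affine (\<lambda>Z. H Z Y - l * segre P Z Y)" by (intro complex_affine_diff complex_affine_cmult affH complex_affine_segre)
      show "0 \<in> ball (0 :: 'a cspace) r" using r by simp
      show "H z Y - l * segre P z Y = 0" if "z \<in> ball 0 r" for z
      proof -
        have "cnj (H Y z) = - cnj l * segre P z Y" using l[OF that, of Y] by (simp add: segre_cnj)
        then show ?thesis using \<open>l = - cnj l\<close> by (simp add: Hc)
      qed
    qed simp
    then show ?thesis by simp
  qed
  then show ?thesis unfolding H_def by blast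
qed

text \<open>
  The relation \<open>\<sigma> f = p\<close> spreads from an open set to the ball by the identity theorem. If \<open>l\<close> were \<open>0\<close>,
  then \<open>\<langle>f Z, f Y\<rangle> = 1\<close> for all \<open>Y\<close> in an open set, which a regular map does not allow.
\<close>

lemma linear_fractional_at_0:
  fixes f :: "'n::finite cspace \<Rightarrow> 'n cspace"
  assumes f: "regular_on f (ball 0 R)" and R: "0 < R"
    and sph: "\<And>Z. Z \<in> ball 0 R \<Longrightarrow> segre P Z Z = 0 \<Longrightarrow> hermitian (f Z) (f Z) = 1"
  obtains p \<sigma> l where "complex_affine_map p" "complex_affine \<sigma>" "l \<noteq> 0"
    "\<forall>Z\<in>ball 0 R. cscale (\<sigma> Z) (f Z) = p Z"
    "\<forall>Z Y. hermitian (p Z) (p Y) - \<sigma> Z * cnj (\<sigma> Y) = l * segre P Z Y"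
proof -
  obtain r where r: "0 < r" "r \<le> R" "r \<le> 1"
    and pol: "\<And>Z Y. Z \<in> ball 0 r \<Longrightarrow> Y \<in> ball 0 r \<Longrightarrow> segre P Z Y = 0 \<Longrightarrow> hermitian (f Z) (f Y) = 1"
    using hermitian_eq_1_on_segre[OF regular_on_holomorphic[OF f] R sph] by blast
  have fr: "regular_on f (ball 0 r)"
    by (rule regular_on_subset[OF f]) (use r in \<open>auto intro: subset_ball\<close>)
  obtain p \<sigma> SZ where p: "complex_affine_map p" "complex_affine \<sigma>" and SZ: "open SZ" "SZ \<noteq> {}" "SZ \<subseteq> ball 0 r"
    "\<forall>Z\<in>SZ. \<sigma> Z \<noteq> 0 \<and> cscale (\<sigma> Z) (f Z) = p Z"
    by (rule linear_fractional_on_open[OF fr r(1,3) pol])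
  have hol: "holomorphic_map_on (\<lambda>Z. cscale (\<sigma> Z) (f Z) - p Z) (ball 0 R)"
    unfolding holomorphic_map_on_def
  proof (intro conjI ballI)
    fix x :: "'n cspace" assume x: "x \<in> ball 0 R"
    obtain D where D: "(f has_derivative D) (at x)" "\<forall>c v. D (cscale c v) = cscale c (D v)" "surj D" "linear D"
      by (rule regular_onD[OF f x])
    have "((\<lambda>Z. cscale (\<sigma> Z) (f Z) - p Z) has_derivative
        (\<lambda>u. cscale (\<sigma> x) (D u) + cscale (\<sigma> u - \<sigma> 0) (f x) - (p u - p 0))) (at x)"
      by (intro derivative_intros D(1) complex_affine_has_derivative complex_affine_map_has_derivative p)
    moreover have "cscale (\<sigma> x) (D (cscale c v)) + cscale (\<sigma> (cscale c v) - \<sigma> 0) (f x) - (p (cscale c v) - p 0)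
      = cscale c (cscale (\<sigma> x) (D v) + cscale (\<sigma> v - \<sigma> 0) (f x) - (p v - p 0))" for c v
      by (simp add: D(2) complex_affine_cscale[OF p(2)] complex_affine_map_cscale[OF p(1)] cscale_alg mult.commute algebra_simps)
    ultimately show "\<exists>D. ((\<lambda>Z. cscale (\<sigma> Z) (f Z) - p Z) has_derivative D) (at x) \<and>
        (\<forall>c v. D (cscale c v) = cscale c (D v))" by blast
  qed simp
  have SZR: "SZ \<subseteq> ball 0 R" using SZ(3) r(2) by (meson order_trans subset_ball)
  have ext: "cscale (\<sigma> Z) (f Z) = p Z" if "Z \<in> ball 0 R" for Z
    using holomorphic_map_identity[OF hol convex_ball SZ(1,2) SZR _ that] SZ(4) by simp
  have scal: "hermitian (p Z) (p Y) = \<sigma> Z * cnj (\<sigma> Y) * hermitian (f Z) (f Y)" if "Z \<in> ball 0 R" "Y \<in> ball 0 R" for Z Y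
    using ext[OF that(1), symmetric] ext[OF that(2), symmetric] by (simp add: hermitian_scale)
  obtain l where l: "\<And>Z Y. hermitian (p Z) (p Y) - \<sigma> Z * cnj (\<sigma> Y) = l * segre P Z Y"
  proof -
    have "\<exists>l. \<forall>Z Y. hermitian (p Z) (p Y) - \<sigma> Z * cnj (\<sigma> Y) = l * segre P Z Y"
    proof (rule hermitian_form_proportional_to_segre[OF p r(1)])
      fix Z Y :: "'n cspace" assume "Z \<in> ball 0 r" "Y \<in> ball 0 r" "segre P Z Y = 0"
      then show "hermitian (p Z) (p Y) = \<sigma> Z * cnj (\<sigma> Y)"
        using scal[of Z Y] pol[of Z Y] r(2) by simp
    qed
    then show ?thesis using that by blast
  qed
  have l0: "l \<noteq> 0"
  proof
    assume "l = 0"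
    obtain Z where Z: "Z \<in> SZ" using SZ(2) by blast
    have "hermitian (f Z) (f Y) = 1" if Y: "Y \<in> SZ" for Y
    proof -
      have "Z \<in> ball 0 R" "Y \<in> ball 0 R" using Z Y SZR by blast+
      from scal[OF this] have "\<sigma> Z * cnj (\<sigma> Y) * hermitian (f Z) (f Y) = \<sigma> Z * cnj (\<sigma> Y)"
        using l[of Z Y] \<open>l = 0\<close> by simp
      then show ?thesis using SZ(4) Z Y by simp
    qed
    then show False by (rule hermitian_not_locally_one[OF f SZ(1,2) SZR])
  qed
  show thesis by (rule that[OF p l0]) (use ext l in auto)
qed

text \<open>
  The translation by \<open>C\<close> in the Heisenberg group. For \<open>C\<close> in \<open>hyperquadric P\<close> it is an affine
  automorphism of the hyperquadric that moves \<open>0\<close> to \<open>C\<close>.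
\<close>

definition heisenberg :: "'n::finite set \<Rightarrow> 'n cspace \<Rightarrow> 'n cspace \<Rightarrow> 'n cspace" where
  "heisenberg P C Z = (fst Z + fst C, snd Z + snd C + 2 * \<i> * qform P (fst Z) (fst C))"

definition heisenberg_inv :: "'n::finite set \<Rightarrow> 'n cspace \<Rightarrow> 'n cspace \<Rightarrow> 'n cspace" where
  "heisenberg_inv P C Z = (fst Z - fst C, snd Z - snd C - 2 * \<i> * qform P (fst Z - fst C) (fst C))"

lemma heisenberg_inverse [simp]: "heisenberg P C (heisenberg_inv P C Z) = Z" "heisenberg_inv P C (heisenberg P C Z) = Z"
  by (simp_all add: heisenberg_def heisenberg_inv_def prod_eq_iff)

lemma heisenberg_0 [simp]: "heisenberg P C 0 = C"
  by (simp add: heisenberg_def)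

lemma segre_heisenberg:
  assumes "segre P C C = 0" shows "segre P (heisenberg P C Z) (heisenberg P C Y) = segre P Z Y"
proof -
  have "snd C - cnj (snd C) = 2 * \<i> * qform P (fst C) (fst C)" using assms by (simp add: segre_def)
  then show ?thesis
    by (simp add: segre_def heisenberg_def qform_add qform_cnj algebra_simps)
qed

lemma complex_affine_map_heisenberg: "complex_affine_map (heisenberg P C)" "complex_affine_map (heisenberg_inv P C)"
  by (auto simp: complex_affine_map_def heisenberg_def heisenberg_inv_def prod_eq_iff vec_eq_iff qform_add qform_diff qform_scale qform_minus algebra_simps)

lemma complex_affine_comp: "complex_affine F \<Longrightarrow> complex_affine_map g \<Longrightarrow> complex_affine (\<lambda>Z. F (g Z))"
  and complex_affine_map_comp: "complex_affine_map q \<Longrightarrow> complex_affine_map g \<Longrightarrow> complex_affine_map (\<lambda>Z. q (g Z))"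
proof -
  show "complex_affine (\<lambda>Z. F (g Z))" if F: "complex_affine F" and g: "complex_affine_map g"
  proof (rule complex_affineI)
    have s: "F (a + cscale c (x - b)) = F a + c * (F x - F b)" for a b c x
    proof -
      have "F x - F b = F (x - b) - F 0" using complex_affine_plus[OF F, of "x - b" b] by simp
      then show ?thesis using complex_affineD[OF F, of a c "x - b"] by simp
    qed
    show "F (g (x + y)) = F (g x) + F (g y) - F (g 0)" for x y
      using s[of "g x" 1 "g y" "g 0"] by (simp add: complex_affine_map_plus[OF g] cscale_alg algebra_simps)
    show "F (g (cscale c x)) = F (g 0) + c * (F (g x) - F (g 0))" for c x
      using s[of "g 0" c "g x" "g 0"] by (simp add: complex_affine_map_cscale[OF g])
  qed
  show "complex_affine_map (\<lambda>Z. q (g Z))" if F: "complex_affine_map q" and g: "complex_affine_map g"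
    unfolding complex_affine_map_def
  proof (intro conjI allI)
    have s: "q (a + cscale c (x - b)) = q a + cscale c (q x - q b)" for a b c x
    proof -
      have "q x - q b = q (x - b) - q 0" using complex_affine_map_plus[OF F, of "x - b" b] by simp
      then show ?thesis using complex_affine_mapD[OF F, of a c "x - b"] by simp
    qed
    show "q (g (x + y)) + q (g 0) = q (g x) + q (g y)" for x y
      using s[of "g x" 1 "g y" "g 0"] by (simp add: complex_affine_map_plus[OF g] cscale_alg algebra_simps)
    show "q (g (cscale c x)) = q (g 0) + cscale c (q (g x) - q (g 0))" for c x
      using s[of "g 0" c "g x" "g 0"] by (simp add: complex_affine_map_cscale[OF g])
  qed
qed

text \<open>
  Heisenberg translations reduce the case of an arbitrary base point to the base point \<open>0\<close>.
\<close>

theorem linear_fractional: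
  fixes f :: "'n::finite cspace \<Rightarrow> 'n cspace"
  assumes f: "regular_on f S" and C: "C \<in> S" "C \<in> hyperquadric P"
    and sph: "f ` (S \<inter> hyperquadric P) \<subseteq> sphere 0 1"
  obtains p \<sigma> l N where "complex_affine_map p" "complex_affine \<sigma>" "l \<noteq> 0" "open N" "C \<in> N" "N \<subseteq> S"
    "\<forall>Z\<in>N. cscale (\<sigma> Z) (f Z) = p Z"
    "\<forall>Z Y. hermitian (p Z) (p Y) - \<sigma> Z * cnj (\<sigma> Y) = l * segre P Z Y"
proof -
  have segC: "segre P C C = 0" using C by (simp add: hyperquadric_iff_segre)
  have oS: "open S" using f by (simp add: regular_on_def)
  have cont: "continuous_on UNIV (heisenberg P C)" "continuous_on UNIV (heisenberg_inv P C)"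
    unfolding heisenberg_def[abs_def] heisenberg_inv_def[abs_def] by (intro continuous_intros)+
  have "open (heisenberg P C -` S)" "0 \<in> heisenberg P C -` S" using oS cont C by (auto simp: open_vimage)
  then obtain R where R: "R > 0" "ball 0 R \<subseteq> heisenberg P C -` S" by (meson open_contains_ball)
  have reg: "regular_on (\<lambda>Z. f (heisenberg P C Z)) (ball 0 R)"
    unfolding regular_on_def
  proof (intro conjI ballI)
    fix x :: "'n cspace" assume "x \<in> ball 0 R"
    then have x: "heisenberg P C x \<in> S" using R by auto
    obtain D where D: "(f has_derivative D) (at (heisenberg P C x))" "\<forall>c v. D (cscale c v) = cscale c (D v)" "surj D" "linear D"
      by (rule regular_onD[OF f x])
    define T where "T u = heisenberg P C u - heisenberg P C 0" for u
    have "(heisenberg P C has_derivative T) (at x)"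
      unfolding T_def[abs_def] by (rule complex_affine_map_has_derivative[OF complex_affine_map_heisenberg(1)])
    from has_derivative_compose[OF this D(1)]
    have "((\<lambda>Z. f (heisenberg P C Z)) has_derivative (\<lambda>u. D (T u))) (at x)" .
    moreover have "D (T (cscale c v)) = cscale c (D (T v))" for c v
    proof -
      have "T (cscale c v) = cscale c (T v)"
        unfolding T_def complex_affine_map_cscale[OF complex_affine_map_heisenberg(1), of P C c v] by simp
      then show ?thesis by (simp add: D(2))
    qed
    moreover have "surj (\<lambda>u. D (T u))"
    proof -
      have "T (heisenberg_inv P C (u + C)) = u" for u by (simp add: T_def)
      then have "surj T" by (rule surjI)
      then show ?thesis using D(3) comp_surj[of T D] by (simp add: o_def)
    qed
    ultimately show "\<exists>D. ((\<lambda>Z. f (heisenberg P C Z)) has_derivative D) (at x) \<and>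
        (\<forall>c v. D (cscale c v) = cscale c (D v)) \<and> surj D" by blast
  qed simp
  have "hermitian (f (heisenberg P C Z)) (f (heisenberg P C Z)) = 1" if "Z \<in> ball 0 R" "segre P Z Z = 0" for Z
  proof -
    have "heisenberg P C Z \<in> S \<inter> hyperquadric P"
      using that R segre_heisenberg[OF segC] by (auto simp: hyperquadric_iff_segre)
    then have "norm (f (heisenberg P C Z)) = 1" using sph by auto
    then show ?thesis by (simp add: hermitian_self)
  qed
  then obtain p \<sigma> l where p: "complex_affine_map p" "complex_affine \<sigma>" "l \<noteq> 0"
    "\<forall>Z\<in>ball 0 R. cscale (\<sigma> Z) (f (heisenberg P C Z)) = p Z"
    "\<forall>Z Y. hermitian (p Z) (p Y) - \<sigma> Z * cnj (\<sigma> Y) = l * segre P Z Y"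
    by (rule linear_fractional_at_0[OF reg R(1)])
  show thesis
  proof (rule that[of "\<lambda>Z. p (heisenberg_inv P C Z)" "\<lambda>Z. \<sigma> (heisenberg_inv P C Z)" l "heisenberg_inv P C -` ball 0 R"])
    show "open (heisenberg_inv P C -` ball 0 R)" using cont by (simp add: open_vimage)
    show "C \<in> heisenberg_inv P C -` ball 0 R" using R heisenberg_inverse(2)[of P C 0] by simp
    show "heisenberg_inv P C -` ball 0 R \<subseteq> S"
    proof
      fix Z assume "Z \<in> heisenberg_inv P C -` ball 0 R"
      then have "heisenberg P C (heisenberg_inv P C Z) \<in> S" using R(2) by blast
      then show "Z \<in> S" by simp
    qed
    show "\<forall>Z\<in>heisenberg_inv P C -` ball 0 R. cscale (\<sigma> (heisenberg_inv P C Z)) (f Z) = p (heisenberg_inv P C Z)"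
    proof
      fix Z assume "Z \<in> heisenberg_inv P C -` ball 0 R"
      then show "cscale (\<sigma> (heisenberg_inv P C Z)) (f Z) = p (heisenberg_inv P C Z)"
        using bspec[OF p(4), of "heisenberg_inv P C Z"] by simp
    qed
    show "\<forall>Z Y. hermitian (p (heisenberg_inv P C Z)) (p (heisenberg_inv P C Y)) -
        \<sigma> (heisenberg_inv P C Z) * cnj (\<sigma> (heisenberg_inv P C Y)) = l * segre P Z Y"
    proof (intro allI)
      fix Z Y
      show "hermitian (p (heisenberg_inv P C Z)) (p (heisenberg_inv P C Y)) -
        \<sigma> (heisenberg_inv P C Z) * cnj (\<sigma> (heisenberg_inv P C Y)) = l * segre P Z Y"
        using p(5)[rule_format, of "heisenberg_inv P C Z" "heisenberg_inv P C Y"]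
          segre_heisenberg[OF segC, of "heisenberg_inv P C Z" "heisenberg_inv P C Y"] by simp
    qed
  qed (rule complex_affine_map_comp[OF p(1) complex_affine_map_heisenberg(2)] complex_affine_comp[OF p(2) complex_affine_map_heisenberg(2)] p(3))+
qed

section \<open>Biholomorphy of the linear fractional map\<close>

text \<open>
  The counterpart of \<open>biholomorphic_on\<close> for open subsets of the model space.
\<close>

definition biholomorphic_map_on :: "('n::finite cspace \<Rightarrow> 'n cspace) \<Rightarrow> 'n cspace set \<Rightarrow> bool" where
  "biholomorphic_map_on f S \<longleftrightarrow>
     holomorphic_map_on f S \<and> inj_on f S \<and> holomorphic_map_on (inv_into S f) (f ` S)"

lemma regular_on_if_inverse:
  assumes f: "holomorphic_map_on f S" and g: "holomorphic_map_on g (f ` S)"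
    and gf: "\<And>x. x \<in> S \<Longrightarrow> g (f x) = x"
  shows "regular_on f S"
  unfolding regular_on_def
proof (intro conjI ballI)
  show oS: "open S" using f by (simp add: holomorphic_map_on_def)
  fix x assume x: "x \<in> S"
  obtain D where D: "(f has_derivative D) (at x)" "\<forall>c v. D (cscale c v) = cscale c (D v)"
    using f x unfolding holomorphic_map_on_def by blast
  have "f x \<in> f ` S" using x by blast
  then obtain E where E: "(g has_derivative E) (at (f x))"
    using g unfolding holomorphic_map_on_def by blast
  have "((\<lambda>y. g (f y)) has_derivative (\<lambda>u. E (D u))) (at x)"
    by (rule has_derivative_compose[OF D(1) E])
  then have "((\<lambda>y. y) has_derivative (\<lambda>u. E (D u))) (at x)"
    by (rule has_derivative_transform_within_open[OF _ oS x]) (rule gf)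
  from has_derivative_unique[OF this has_derivative_ident]
  have "E (D u) = u" for u by (rule fun_cong)
  then have "inj D" by (rule inj_on_inverseI)
  then have "surj D"
    using linear_injective_imp_surjective[OF has_derivative_linear[OF D(1)]] by blast
  then show "\<exists>D. (f has_derivative D) (at x) \<and> (\<forall>c v. D (cscale c v) = cscale c (D v)) \<and> surj D"
    using D by blast
qed

text \<open>
  Openness of the image is invariance of domain; the derivative of the inverse is the inverse of the
  derivative, hence complex linear.
\<close>

lemma biholomorphic_map_onI:
  assumes f: "holomorphic_map_on f S" and inj: "inj_on f S"
    and der: "\<And>x. x \<in> S \<Longrightarrow> \<exists>D. (f has_derivative D) (at x) \<and> (\<forall>c v. D (cscale c v) = cscale c (D v)) \<and> inj D"
  shows "biholomorphic_map_on f S"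
  unfolding biholomorphic_map_on_def
proof (intro conjI f inj)
  have oS: "open S" using f by (simp add: holomorphic_map_on_def)
  have cf: "continuous_on S f" using f by (rule holomorphic_map_on_continuous)
  show "holomorphic_map_on (inv_into S f) (f ` S)"
    unfolding holomorphic_map_on_def
  proof (intro conjI ballI)
    show "open (f ` S)" by (rule invariance_of_domain[OF cf oS inj])
    fix y assume "y \<in> f ` S"
    then obtain x where x: "x \<in> S" "y = f x" by blast
    obtain D where D: "(f has_derivative D) (at x)" "\<forall>c v. D (cscale c v) = cscale c (D v)" "inj D"
      using der[OF x(1)] by blast
    define E where "E = inv D"
    have ED: "E (D u) = u" for u unfolding E_def using D(3) by (rule inv_f_f)
    have "surj D"
      using linear_injective_imp_surjective[OF has_derivative_linear[OF D(1)] D(3)] by simp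
    then have DE: "D (E u) = u" for u unfolding E_def by (rule surj_f_inv_f)
    have "(inv_into S f has_derivative E) (at (f x))"
    proof (rule has_derivative_inverse_strong[OF oS x(1) cf _ D(1)])
      show "inv_into S f (f z) = z" if "z \<in> S" for z using inv_into_f_f[OF inj that] .
      show "D \<circ> E = id" by (simp add: fun_eq_iff DE)
    qed
    moreover have "E (cscale c v) = cscale c (E v)" for c v
      using ED[of "cscale c (E v)"] by (simp add: D(2) DE)
    ultimately show "\<exists>D. (inv_into S f has_derivative D) (at y) \<and> (\<forall>c v. D (cscale c v) = cscale c (D v))"
      using x(2) by blast
  qed
qed

text \<open>
  Nondegeneracy of the polarised equation: a point is determined by its Segre pairing, even up to a factor,
  since the coefficient of \<open>cnj (snd Y)\<close> is fixed.
\<close>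

lemma segre_proportional_eq:
  assumes "\<And>Y. segre P Z1 Y = c * segre P Z2 Y"
  shows "Z1 = Z2"
proof -
  have 0: "snd Z1 = c * snd Z2" using assms[of 0] by (simp add: segre_def)
  have "snd Z1 - 1 = c * (snd Z2 - 1)" using assms[of "(0, 1)"] by (simp add: segre_def)
  with 0 have c: "c = 1" by (simp add: algebra_simps)
  have q: "qform P (fst Z1) y = qform P (fst Z2) y" for y
    using assms[of "(y, 0)"] 0 by (simp add: segre_def c)
  have "fst Z1 - fst Z2 = 0"
  proof (rule ccontr)
    assume "fst Z1 - fst Z2 \<noteq> 0"
    then obtain a where "qform P a (fst Z1 - fst Z2) \<noteq> 0" using qform_nondegenerate by blast
    then have "cnj (qform P a (fst Z1 - fst Z2)) \<noteq> 0" by (simp only: complex_cnj_zero_iff not_False_eq_True)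
    then show False using q by (simp add: qform_cnj qform_diff)
  qed
  then show ?thesis using 0 c by (simp add: prod_eq_iff)
qed

text \<open>
  Both injectivity statements concern vectors \<open>(p, \<sigma>)\<close> that are proportional. The form identity turns
  them into proportional functions \<open>segre P Z1\<close> and \<open>segre P Z2\<close> (for the derivative: \<open>segre P u - segre P 0\<close>
  and \<open>segre P x\<close>), and nondegeneracy of \<open>segre P\<close> applies.
\<close>

lemma linear_fractional_biholomorphic:
  fixes p :: "'n::finite cspace \<Rightarrow> 'n cspace"
  assumes p: "complex_affine_map p" and s: "complex_affine \<sigma>" and l: "l \<noteq> 0"
    and form: "\<forall>Z Y. hermitian (p Z) (p Y) - \<sigma> Z * cnj (\<sigma> Y) = l * segre P Z Y"
  shows "biholomorphic_map_on (\<lambda>Z. cscale (inverse (\<sigma> Z)) (p Z)) {Z. \<sigma> Z \<noteq> 0}"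
proof (rule biholomorphic_map_onI)
  let ?T = "\<lambda>Z. cscale (inverse (\<sigma> Z)) (p Z)"
  have der: "\<exists>D. (?T has_derivative D) (at x) \<and> (\<forall>c v. D (cscale c v) = cscale c (D v)) \<and> inj D"
    if x: "x \<in> {Z. \<sigma> Z \<noteq> 0}" for x
  proof -
    have sx: "\<sigma> x \<noteq> 0" using x by simp
    define dp where "dp u = p u - p 0" for u
    define ds where "ds u = \<sigma> u - \<sigma> 0" for u
    have dpc: "dp (cscale c u) = cscale c (dp u)" for c u
      unfolding dp_def complex_affine_map_cscale[OF p, of c u] by simp
    have dsc: "ds (cscale c u) = c * ds u" for c u
      unfolding ds_def complex_affine_cscale[OF s, of c u] by simp
    define D where "D u = cscale (inverse (\<sigma> x)) (dp u)
        + cscale (- (inverse (\<sigma> x) * ds u * inverse (\<sigma> x))) (p x)" for u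
    have hd: "(?T has_derivative D) (at x)"
      unfolding D_def[abs_def] dp_def ds_def
      by (intro derivative_intros complex_affine_has_derivative complex_affine_map_has_derivative p s sx)
    have hom: "D (cscale c v) = cscale c (D v)" for c v
      by (simp add: D_def dpc dsc cscale_alg mult.commute mult.left_commute)
    have "inj D"
      unfolding linear_injective_0[OF has_derivative_linear[OF hd]]
    proof (intro allI impI)
      fix u assume "D u = 0"
      define c where "c = ds u / \<sigma> x"
      have "cscale (\<sigma> x) (D u) = dp u - cscale c (p x)"
        using sx by (simp add: D_def cscale_alg c_def field_simps)
          (simp add: cscale_def prod_eq_iff vec_eq_iff)
      then have dpu: "dp u = cscale c (p x)" using \<open>D u = 0\<close> by (simp add: cscale_alg)
      have dsu: "ds u = c * \<sigma> x" using sx by (simp add: c_def)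
      have rel: "segre P u Y - segre P 0 Y = c * segre P x Y" for Y
      proof -
        have "l * (segre P u Y - segre P 0 Y) = hermitian (dp u) (p Y) - ds u * cnj (\<sigma> Y)"
          using form[rule_format, of u Y] form[rule_format, of 0 Y]
          by (simp add: dp_def ds_def hermitian_diff algebra_simps)
        also have "\<dots> = c * (hermitian (p x) (p Y) - \<sigma> x * cnj (\<sigma> Y))"
          by (simp add: dpu dsu hermitian_scale algebra_simps)
        also have "\<dots> = l * (c * segre P x Y)" using form[rule_format, of x Y] by simp
        finally show ?thesis using l by (metis mult_left_cancel)
      qed
      have "snd u = c * snd x" using rel[of 0] by (simp add: segre_def)
      moreover have "snd u = c * (snd x - 1)" using rel[of "(0, 1)"] by (simp add: segre_def)
      ultimately have "c = 0" by (simp add: algebra_simps)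
      then have "segre P u Y = 1 * segre P 0 Y" for Y using rel[of Y] by simp
      then show "u = 0" by (rule segre_proportional_eq)
    qed
    then show ?thesis using hd hom by blast
  qed
  have "open {Z. \<sigma> Z \<noteq> 0}"
    by (intro open_Collect_neq complex_affine_continuous s continuous_on_const)
  then show "holomorphic_map_on ?T {Z. \<sigma> Z \<noteq> 0}"
    unfolding holomorphic_map_on_def using der by blast
  show "inj_on ?T {Z. \<sigma> Z \<noteq> 0}"
  proof (rule inj_onI)
    fix Z1 Z2 assume Z: "Z1 \<in> {Z. \<sigma> Z \<noteq> 0}" "Z2 \<in> {Z. \<sigma> Z \<noteq> 0}" and eq: "?T Z1 = ?T Z2"
    define c where "c = \<sigma> Z1 / \<sigma> Z2"
    have "cscale (\<sigma> Z1) (?T Z1) = cscale (\<sigma> Z1) (?T Z2)" using eq by simp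
    then have p1: "p Z1 = cscale c (p Z2)" using Z by (simp add: cscale_alg c_def divide_inverse)
    have s1: "\<sigma> Z1 = c * \<sigma> Z2" using Z by (simp add: c_def)
    show "Z1 = Z2"
    proof (rule segre_proportional_eq)
      fix Y
      have "l * segre P Z1 Y = hermitian (p Z1) (p Y) - \<sigma> Z1 * cnj (\<sigma> Y)" using form by metis
      also have "\<dots> = c * (hermitian (p Z2) (p Y) - \<sigma> Z2 * cnj (\<sigma> Y))"
        by (simp add: p1 s1 hermitian_scale algebra_simps)
      also have "\<dots> = l * (c * segre P Z2 Y)" using form[rule_format, of Z2 Y] by simp
      finally show "segre P Z1 Y = c * segre P Z2 Y" using l by (metis mult_left_cancel)
    qed
  qed
  show "\<exists>D. (?T has_derivative D) (at x) \<and> (\<forall>c v. D (cscale c v) = cscale c (D v)) \<and> inj D"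
    if "x \<in> {Z. \<sigma> Z \<noteq> 0}" for x using that by (rule der)
qed

text \<open>
  On the hyperquadric \<open>|p| = |\<sigma>|\<close>. A zero of \<open>\<sigma>\<close> would also be a zero of \<open>p\<close>, so \<open>segre P Z\<close> would vanish
  identically.
\<close>

lemma linear_fractional_on_hyperquadric:
  fixes p :: "'n::finite cspace \<Rightarrow> 'n cspace"
  assumes l: "l \<noteq> 0"
    and form: "\<forall>Z Y. hermitian (p Z) (p Y) - \<sigma> Z * cnj (\<sigma> Y) = l * segre P Z Y"
    and Z: "Z \<in> hyperquadric P"
  shows "\<sigma> Z \<noteq> 0" "cscale (inverse (\<sigma> Z)) (p Z) \<in> sphere 0 1"
proof -
  have eq: "hermitian (p Z) (p Z) = \<sigma> Z * cnj (\<sigma> Z)"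
    using form[rule_format, of Z Z] Z by (simp add: hyperquadric_iff_segre)
  show nz: "\<sigma> Z \<noteq> 0"
  proof
    assume 0: "\<sigma> Z = 0"
    then have "p Z = 0" using eq by (simp add: hermitian_self)
    then have "l * segre P Z Y = 0" for Y using form[rule_format, of Z Y] 0 by simp
    then have "segre P Z 0 = 0" "segre P Z (0, 1) = 0" using l by (metis mult_eq_0_iff)+
    then show False by (simp add: segre_def)
  qed
  have "hermitian (cscale (inverse (\<sigma> Z)) (p Z)) (cscale (inverse (\<sigma> Z)) (p Z)) = 1"
    using nz by (simp add: hermitian_scale eq field_simps)
  then have "(norm (cscale (inverse (\<sigma> Z)) (p Z)))\<^sup>2 = 1"
    unfolding hermitian_self by (simp only: of_real_eq_1_iff)
  then show "cscale (inverse (\<sigma> Z)) (p Z) \<in> sphere 0 1"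
    by (simp add: power2_eq_1_iff) (metis norm_ge_zero neg_0_le_iff_le not_one_le_zero)
qed

section \<open>Biholomorphic maps on a complex manifold\<close>

lemma holomorphic_map_on_locally:
  assumes "open S" "\<And>x. x \<in> S \<Longrightarrow> \<exists>T. x \<in> T \<and> holomorphic_map_on f T"
  shows "holomorphic_map_on f S"
  using assms unfolding holomorphic_map_on_def by blast

lemma holomorphic_map_on_compose:
  assumes g: "holomorphic_map_on g S" and h: "holomorphic_map_on h T"
    and U: "open U" "U \<subseteq> S" "g ` U \<subseteq> T" and eq: "\<And>x. x \<in> U \<Longrightarrow> f x = h (g x)"
  shows "holomorphic_map_on f U"
  unfolding holomorphic_map_on_def
proof (intro conjI ballI U(1))
  fix x assume x: "x \<in> U"
  then have "x \<in> S" "g x \<in> T" using U by auto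
  obtain D where D: "(g has_derivative D) (at x)" "\<forall>c v. D (cscale c v) = cscale c (D v)"
    using g \<open>x \<in> S\<close> unfolding holomorphic_map_on_def by blast
  obtain E where E: "(h has_derivative E) (at (g x))" "\<forall>c v. E (cscale c v) = cscale c (E v)"
    using h \<open>g x \<in> T\<close> unfolding holomorphic_map_on_def by blast
  have "((\<lambda>x. h (g x)) has_derivative (\<lambda>u. E (D u))) (at x)"
    by (rule has_derivative_compose[OF D(1) E(1)])
  then have "(f has_derivative (\<lambda>u. E (D u))) (at x)"
    by (rule has_derivative_transform_within_open[OF _ U(1) x]) (simp add: eq)
  moreover have "E (D (cscale c v)) = cscale c (E (D v))" for c v
    by (simp only: D(2)[rule_format] E(2)[rule_format])
  ultimately show "\<exists>D. (f has_derivative D) (at x) \<and> (\<forall>c v. D (cscale c v) = cscale c (D v))"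
    by blast
qed

lemma open_image_inverse_continuous:
  assumes "open (f ` S)" "continuous_on (f ` S) (inv_into S f)" "inj_on f S" "open T"
  shows "open (f ` (S \<inter> T))"
proof -
  have "f ` (S \<inter> T) = f ` S \<inter> inv_into S f -` T"
    using assms(3) by (auto simp: inj_on_def)
  then show ?thesis using continuous_open_preimage[OF assms(2,1,4)] by simp
qed

lemma chart_props:
  assumes A: "complex_atlas A" "(V, \<kappa>) \<in> A"
  shows "open V" "inj_on \<kappa> V" "continuous_on V \<kappa>" "open (\<kappa> ` V)"
    "continuous_on (\<kappa> ` V) (inv_into V \<kappa>)"
proof -
  have "open V" "open (\<kappa> ` V)" and h: "homeomorphism V (\<kappa> ` V) \<kappa> (inv_into V \<kappa>)"
    using A unfolding complex_atlas_def by blast+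
  then show "open V" "open (\<kappa> ` V)" by auto
  show "continuous_on V \<kappa>" "continuous_on (\<kappa> ` V) (inv_into V \<kappa>)"
    using h unfolding homeomorphism_def by auto
  show "inj_on \<kappa> V" by (rule inj_on_inverseI[of V "inv_into V \<kappa>"]) (rule homeomorphism_apply1[OF h])
qed

lemma chart_open_image:
  "complex_atlas A \<Longrightarrow> (V, \<kappa>) \<in> A \<Longrightarrow> open T \<Longrightarrow> open (\<kappa> ` (V \<inter> T))"
  by (rule open_image_inverse_continuous[OF chart_props(4) chart_props(5) chart_props(2)])

lemma chart_at:
  assumes "complex_atlas A" obtains V \<kappa> where "(V, \<kappa>) \<in> A" "x \<in> V"
proof -
  have "x \<in> (\<Union>(V, \<kappa>)\<in>A. V)" using assms unfolding complex_atlas_def by auto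
  then show thesis using that by auto
qed

lemma biholomorphic_onD:
  assumes "biholomorphic_on A f W"
  shows "open W" "inj_on f W" "open (f ` W)" "continuous_on (f ` W) (inv_into W f)"
    "\<And>V \<kappa>. (V, \<kappa>) \<in> A \<Longrightarrow> holomorphic_map_on (f \<circ> inv_into V \<kappa>) (\<kappa> ` (V \<inter> W))"
    "\<And>V \<kappa>. (V, \<kappa>) \<in> A \<Longrightarrow> holomorphic_map_on (\<kappa> \<circ> inv_into W f) (f ` (W \<inter> V))"
  using assms unfolding biholomorphic_on_def mfd_holomorphic_on_def by blast+

lemma biholomorphic_on_open_image:
  "biholomorphic_on A f W \<Longrightarrow> open T \<Longrightarrow> open (f ` (W \<inter> T))"
  by (rule open_image_inverse_continuous[OF biholomorphic_onD(3) biholomorphic_onD(4) biholomorphic_onD(2)])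

lemma biholomorphic_on_continuous:
  assumes A: "complex_atlas A" and f: "biholomorphic_on A f W"
  shows "continuous_on W f"
proof (rule continuous_at_imp_continuous_on, rule ballI)
  fix x assume x: "x \<in> W"
  obtain V \<kappa> where V: "(V, \<kappa>) \<in> A" "x \<in> V" using chart_at[OF A] .
  have o: "open (V \<inter> W)" using chart_props(1)[OF A V(1)] biholomorphic_onD(1)[OF f] by blast
  have "continuous_on (V \<inter> W) ((f \<circ> inv_into V \<kappa>) \<circ> \<kappa>)"
    by (intro continuous_on_compose holomorphic_map_on_continuous biholomorphic_onD(5)[OF f V(1)]
        continuous_on_subset[OF chart_props(3)[OF A V(1)]]) auto
  then have "continuous_on (V \<inter> W) f"
    by (rule continuous_on_eq) (simp add: inv_into_f_f[OF chart_props(2)[OF A V(1)]])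
  then show "isCont f x" using o x V(2) by (simp add: continuous_on_eq_continuous_at)
qed

lemma biholomorphic_on_open_preimage:
  "complex_atlas A \<Longrightarrow> biholomorphic_on A f W \<Longrightarrow> open S \<Longrightarrow> open {x \<in> W. f x \<in> S}"
  using continuous_open_preimage[OF biholomorphic_on_continuous biholomorphic_onD(1), of A f W A f S]
  by (simp add: vimage_def Int_def)

text \<open>
  Near each point the transition map factors through a chart of the atlas.
\<close>

lemma transition_holomorphic:
  assumes A: "complex_atlas A" and f: "biholomorphic_on A f W" and g: "biholomorphic_on A g W'"
  shows "holomorphic_map_on (g \<circ> inv_into W f) (f ` (W \<inter> W'))"
proof (rule holomorphic_map_on_locally)
  show "open (f ` (W \<inter> W'))"
    by (rule biholomorphic_on_open_image[OF f biholomorphic_onD(1)[OF g]])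
  fix y assume "y \<in> f ` (W \<inter> W')"
  then obtain x where x: "x \<in> W" "x \<in> W'" "y = f x" by blast
  obtain V \<kappa> where V: "(V, \<kappa>) \<in> A" "x \<in> V" using chart_at[OF A] .
  have iv: "inv_into W f (f z) = z" if "z \<in> W" for z
    using inv_into_f_f[OF biholomorphic_onD(2)[OF f] that] .
  have ik: "inv_into V \<kappa> (\<kappa> z) = z" if "z \<in> V" for z
    using inv_into_f_f[OF chart_props(2)[OF A V(1)] that] .
  have "holomorphic_map_on (g \<circ> inv_into W f) (f ` (W \<inter> (V \<inter> W')))"
  proof (rule holomorphic_map_on_compose[OF biholomorphic_onD(6)[OF f V(1)] biholomorphic_onD(5)[OF g V(1)]])
    show "open (f ` (W \<inter> (V \<inter> W')))"
      using biholomorphic_on_open_image[OF f, of "V \<inter> W'"] chart_props(1)[OF A V(1)] biholomorphic_onD(1)[OF g]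
      by blast
    show "(\<kappa> \<circ> inv_into W f) ` f ` (W \<inter> (V \<inter> W')) \<subseteq> \<kappa> ` (V \<inter> W')"
      using iv by auto
    show "(g \<circ> inv_into W f) z = (g \<circ> inv_into V \<kappa>) ((\<kappa> \<circ> inv_into W f) z)" if "z \<in> f ` (W \<inter> (V \<inter> W'))" for z
      using that iv ik by auto
  qed auto
  moreover have "y \<in> f ` (W \<inter> (V \<inter> W'))" using x V(2) by simp
  ultimately show "\<exists>T. y \<in> T \<and> holomorphic_map_on (g \<circ> inv_into W f) T" by (intro exI conjI)
qed

lemma biholomorphic_on_compose:
  assumes A: "complex_atlas A" and f: "biholomorphic_on A f W" and T: "biholomorphic_map_on T S"
  shows "biholomorphic_on A (T \<circ> f) {x \<in> W. f x \<in> S}"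
proof -
  define N where "N = {x \<in> W. f x \<in> S}"
  have T': "holomorphic_map_on T S" "inj_on T S" "holomorphic_map_on (inv_into S T) (T ` S)"
    using T by (auto simp: biholomorphic_map_on_def)
  then have oS: "open S" "open (T ` S)" by (auto simp: holomorphic_map_on_def)
  have oN: "open N" unfolding N_def by (rule biholomorphic_on_open_preimage[OF A f oS(1)])
  have NW: "N \<subseteq> W" "f ` N \<subseteq> S" by (auto simp: N_def)
  have inj: "inj_on (T \<circ> f) N"
    using NW T'(2) biholomorphic_onD(2)[OF f] by (intro comp_inj_on) (auto intro: inj_on_subset)
  have ofN: "open (f ` X)" if "open X" "X \<subseteq> W" for X
    using biholomorphic_on_open_image[OF f that(1)] that(2) by (simp add: Int_absorb1)
  have oT: "open (T ` X)" if "open X" "X \<subseteq> S" for X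
    using open_image_inverse_continuous[OF oS(2) holomorphic_map_on_continuous[OF T'(3)] T'(2) that(1)] that(2)
    by (simp add: Int_absorb1)
  have oTf: "open ((T \<circ> f) ` X)" if "open X" "X \<subseteq> N" for X
    unfolding image_comp[symmetric] using that NW by (intro oT ofN) auto
  have inv: "inv_into N (T \<circ> f) y = inv_into W f (inv_into S T y)" if y: "y \<in> (T \<circ> f) ` N" for y
  proof -
    obtain x where x: "x \<in> N" "y = T (f x)" using y by auto
    then have "inv_into N (T \<circ> f) y = x" using inv_into_f_f[OF inj x(1)] by simp
    moreover have "inv_into S T y = f x" using x NW T'(2) by (auto simp: N_def)
    moreover have "inv_into W f (f x) = x" using x NW biholomorphic_onD(2)[OF f] by (auto simp: N_def)
    ultimately show ?thesis by simp
  qed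
  have invT: "inv_into S T (T (f x)) = f x" if "x \<in> N" for x
    using that T'(2) by (simp add: N_def)
  have "mfd_holomorphic_on A (T \<circ> f) N"
    unfolding mfd_holomorphic_on_def
  proof (intro conjI oN ballI, clarify)
    fix V \<kappa> assume V: "(V, \<kappa>) \<in> A"
    show "holomorphic_map_on ((T \<circ> f) \<circ> inv_into V \<kappa>) (\<kappa> ` (V \<inter> N))"
    proof (rule holomorphic_map_on_compose[OF biholomorphic_onD(5)[OF f V] T'(1)])
      show "open (\<kappa> ` (V \<inter> N))" by (rule chart_open_image[OF A V oN])
      show "(f \<circ> inv_into V \<kappa>) ` \<kappa> ` (V \<inter> N) \<subseteq> S"
        using NW inv_into_f_f[OF chart_props(2)[OF A V]] by auto
    qed (use NW in auto)
  qed
  moreover have "continuous_on ((T \<circ> f) ` N) (inv_into N (T \<circ> f))"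
  proof -
    have "continuous_on ((T \<circ> f) ` N) (inv_into W f \<circ> inv_into S T)"
    proof (intro continuous_on_compose)
      show "continuous_on ((T \<circ> f) ` N) (inv_into S T)"
        using NW by (intro continuous_on_subset[OF holomorphic_map_on_continuous[OF T'(3)]]) auto
      show "continuous_on (inv_into S T ` (T \<circ> f) ` N) (inv_into W f)"
        using NW invT by (intro continuous_on_subset[OF biholomorphic_onD(4)[OF f]]) auto
    qed
    then show ?thesis by (rule continuous_on_eq) (simp add: inv)
  qed
  moreover have "holomorphic_map_on (\<kappa> \<circ> inv_into N (T \<circ> f)) ((T \<circ> f) ` (N \<inter> V))" if V: "(V, \<kappa>) \<in> A" for V \<kappa>
  proof (rule holomorphic_map_on_compose[OF T'(3) biholomorphic_onD(6)[OF f V]])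
    show "open ((T \<circ> f) ` (N \<inter> V))" using oN chart_props(1)[OF A V] by (intro oTf) auto
    show "(T \<circ> f) ` (N \<inter> V) \<subseteq> T ` S" using NW by auto
    show "inv_into S T ` (T \<circ> f) ` (N \<inter> V) \<subseteq> f ` (W \<inter> V)" using NW invT by auto
    show "(\<kappa> \<circ> inv_into N (T \<circ> f)) y = (\<kappa> \<circ> inv_into W f) (inv_into S T y)" if "y \<in> (T \<circ> f) ` (N \<inter> V)" for y
      using inv[of y] that by auto
  qed
  ultimately show ?thesis
    unfolding biholomorphic_on_def N_def[symmetric] using inj oTf[OF oN order_refl] by blast
qed

text \<open>
  In the coordinates \<open>\<psi>\<close> the germ is linear fractional. The quotient is defined and biholomorphic near
  all of \<open>\<psi> ` W \<inter> hyperquadric P\<close>, so pulling it back by \<open>\<psi>\<close> extends the germ to a neighbourhood of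
  \<open>W \<inter> M\<close>. The extension again maps \<open>M\<close> into the sphere, which allows the step to be repeated.
\<close>

lemma extension_over_spherical_chart:
  fixes A :: "('a::t2_space set \<times> ('a \<Rightarrow> 'n::finite cspace)) set"
  assumes A: "complex_atlas A" and \<psi>: "biholomorphic_on A \<psi> W"
    and M: "\<psi> ` (W \<inter> M) = \<psi> ` W \<inter> hyperquadric P"
    and x: "x \<in> W" "x \<in> M" "x \<in> N" and g: "locally_biholomorphic_on A g N"
    and sph: "g ` (N \<inter> M) \<subseteq> sphere 0 1"
  shows "\<exists>G N'. locally_biholomorphic_on A G N' \<and> W \<inter> M \<subseteq> N' \<and> G ` (N' \<inter> M) \<subseteq> sphere 0 1 \<and>
    (\<forall>\<^sub>F y in nhds x. G y = g y)"
proof -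
  obtain X where X: "x \<in> X" "X \<subseteq> N" and gX: "biholomorphic_on A g X"
    using g x(3) unfolding locally_biholomorphic_on_def by blast
  define S where "S = \<psi> ` (W \<inter> X)"
  have iv: "inv_into W \<psi> (\<psi> y) = y" if "y \<in> W" for y
    using inv_into_f_f[OF biholomorphic_onD(2)[OF \<psi>] that] .
  have ig: "inv_into X g (g y) = y" if "y \<in> X" for y
    using inv_into_f_f[OF biholomorphic_onD(2)[OF gX] that] .
  have MQ: "y \<in> M \<longleftrightarrow> \<psi> y \<in> hyperquadric P" if "y \<in> W" for y
  proof
    assume "\<psi> y \<in> hyperquadric P"
    then have "\<psi> y \<in> \<psi> ` (W \<inter> M)" using M that by blast
    then show "y \<in> M" using biholomorphic_onD(2)[OF \<psi>] that by (auto simp: inj_on_def)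
  qed (use M that in blast)
  define f where "f = g \<circ> inv_into W \<psi>"
  have imf: "f ` S = g ` (X \<inter> W)" using iv by (auto simp: f_def S_def image_iff)
  have reg: "regular_on f S"
  proof (rule regular_on_if_inverse)
    show "holomorphic_map_on f S" unfolding f_def S_def by (rule transition_holomorphic[OF A \<psi> gX])
    show "holomorphic_map_on (\<psi> \<circ> inv_into X g) (f ` S)"
      unfolding imf by (rule transition_holomorphic[OF A gX \<psi>])
    show "(\<psi> \<circ> inv_into X g) (f z) = z" if "z \<in> S" for z
      using that iv ig by (auto simp: f_def S_def)
  qed
  have C: "\<psi> x \<in> S" "\<psi> x \<in> hyperquadric P" using x X MQ by (auto simp: S_def)
  have fs: "f ` (S \<inter> hyperquadric P) \<subseteq> sphere 0 1"
  proof
    fix y assume "y \<in> f ` (S \<inter> hyperquadric P)"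
    then obtain u where u: "u \<in> W" "u \<in> X" "\<psi> u \<in> hyperquadric P" "y = g u"
      using iv by (auto simp: f_def S_def)
    then have "u \<in> N \<inter> M" using X MQ by blast
    then show "y \<in> sphere 0 1" using sph u by blast
  qed
  obtain p \<sigma> l N0 where p: "complex_affine_map p" "complex_affine \<sigma>" "l \<noteq> 0" and N0: "open N0" "\<psi> x \<in> N0" "N0 \<subseteq> S"
    "\<forall>Z\<in>N0. cscale (\<sigma> Z) (f Z) = p Z"
    and form: "\<forall>Z Y. hermitian (p Z) (p Y) - \<sigma> Z * cnj (\<sigma> Y) = l * segre P Z Y"
    by (rule linear_fractional[OF reg C fs])
  define T where "T = (\<lambda>Z. cscale (inverse (\<sigma> Z)) (p Z))"
  define D where "D = {Z. \<sigma> Z \<noteq> 0}"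
  \<comment> \<open>Shrinking \<open>W\<close> to \<open>N'\<close> loses no point of \<open>M\<close>, as \<open>\<sigma>\<close> has no zero on the hyperquadric.\<close>
  define N' where "N' = {y \<in> W. \<psi> y \<in> D}"
  have T: "biholomorphic_map_on T D"
    unfolding T_def D_def by (rule linear_fractional_biholomorphic[OF p form])
  have oD: "open D" using T by (simp add: biholomorphic_map_on_def holomorphic_map_on_def)
  have QD: "Z \<in> D" "T Z \<in> sphere 0 1" if "Z \<in> hyperquadric P" for Z
    using linear_fractional_on_hyperquadric[OF p(3) form that] by (simp_all add: D_def T_def)
  have bih: "biholomorphic_on A (T \<circ> \<psi>) N'"
    unfolding N'_def by (rule biholomorphic_on_compose[OF A \<psi> T])
  have "locally_biholomorphic_on A (T \<circ> \<psi>) N'"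
    unfolding locally_biholomorphic_on_def using bih biholomorphic_onD(1)[OF bih] by blast
  moreover have "W \<inter> M \<subseteq> N'" using MQ QD(1) unfolding N'_def by blast
  moreover have "(T \<circ> \<psi>) ` (N' \<inter> M) \<subseteq> sphere 0 1" 
    using MQ QD(2) unfolding N'_def image_subset_iff o_def by blast
  moreover have "\<forall>\<^sub>F y in nhds x. (T \<circ> \<psi>) y = g y"
    unfolding eventually_nhds
  proof (intro exI conjI ballI)
    show "open {y \<in> W. \<psi> y \<in> N0 \<inter> D}"
      by (rule biholomorphic_on_open_preimage[OF A \<psi>]) (use N0(1) oD in blast)
    show "x \<in> {y \<in> W. \<psi> y \<in> N0 \<inter> D}" using x(1) N0(2) C(2) QD(1) by simp
    fix y assume y: "y \<in> {y \<in> W. \<psi> y \<in> N0 \<inter> D}"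
    then have "p (\<psi> y) = cscale (\<sigma> (\<psi> y)) (f (\<psi> y))" "\<sigma> (\<psi> y) \<noteq> 0" using N0(4) by (auto simp: D_def)
    then show "(T \<circ> \<psi>) y = g y" using y iv by (simp add: T_def cscale_alg f_def)
  qed
  ultimately show ?thesis by blast
qed

section \<open>Continuation along a path\<close>

lemma germ_at_eq: "\<forall>\<^sub>F y in nhds q. f y = g y \<Longrightarrow> germ_at q f = germ_at q g"
  unfolding germ_at_def
  by (auto elim: eventually_elim2)

lemma germ_at_eqD: "germ_at q f = germ_at q g \<Longrightarrow> \<forall>\<^sub>F y in nhds q. f y = g y"
proof -
  assume "germ_at q f = germ_at q g"
  moreover have "f \<in> germ_at q f" by (simp add: germ_at_def)
  ultimately show ?thesis by (simp add: germ_at_def)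
qed

text \<open>
  The condition of \<open>continues_along\<close> on a subinterval, with the family of germs as an argument so that
  families on adjacent intervals can be joined.
\<close>

definition continuation_between ::
    "('a::t2_space set \<times> ('a \<Rightarrow> 'n::finite cspace)) set \<Rightarrow> (real \<Rightarrow> 'a) \<Rightarrow> real \<Rightarrow> real \<Rightarrow>
       (real \<Rightarrow> ('a \<Rightarrow> 'n cspace) set) \<Rightarrow> bool" where
  "continuation_between A \<gamma> a b \<Phi> \<longleftrightarrow>
     (\<forall>t\<in>{a..b}. \<exists>N G. \<gamma> t \<in> N \<and> locally_biholomorphic_on A G N \<and> \<Phi> t = germ_at (\<gamma> t) G \<and>
        (\<forall>\<^sub>F s in at t within {a..b}. \<gamma> s \<in> N \<and> \<Phi> s = germ_at (\<gamma> s) G))"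

lemma continuation_betweenE:
  assumes "continuation_between A \<gamma> a b \<Phi>" "t \<in> {a..b}"
  obtains N G where "\<gamma> t \<in> N" "locally_biholomorphic_on A G N" "\<Phi> t = germ_at (\<gamma> t) G"
    "\<forall>\<^sub>F s in at t within {a..b}. \<gamma> s \<in> N \<and> \<Phi> s = germ_at (\<gamma> s) G"
  using assms unfolding continuation_between_def by blast

text \<open>
  The invariant of the continuation: the germ at \<open>x\<close> is locally biholomorphic and respects \<open>M\<close> and the sphere.
\<close>

definition sphere_germ ::
    "('a::t2_space set \<times> ('a \<Rightarrow> 'n::finite cspace)) set \<Rightarrow> 'a set \<Rightarrow> 'a \<Rightarrow> ('a \<Rightarrow> 'n cspace) \<Rightarrow> bool" where
  "sphere_germ A M x g \<longleftrightarrow>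
     (\<exists>N. x \<in> N \<and> locally_biholomorphic_on A g N \<and> g ` (N \<inter> M) \<subseteq> sphere 0 1)"

text \<open>
  Only the common endpoint \<open>b\<close> needs care. There the representatives \<open>G1\<close> and \<open>G2\<close> of the two families
  have the same germ, so they agree near \<open>\<gamma> b\<close>, and \<open>G2\<close> also represents the germs for \<open>s\<close> slightly
  less than \<open>b\<close>.
\<close>

lemma continuation_join:
  assumes A: "complex_atlas A" and \<gamma>: "continuous_on {a..c} \<gamma>" and abc: "a \<le> b" "b \<le> c"
    and \<Phi>1: "continuation_between A \<gamma> a b \<Phi>1" and \<Phi>2: "continuation_between A \<gamma> b c \<Phi>2"
    and meet: "\<Phi>1 b = \<Phi>2 b"
  shows "continuation_between A \<gamma> a c (\<lambda>t. if t \<le> b then \<Phi>1 t else \<Phi>2 t)"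
  unfolding continuation_between_def
proof
  let ?\<Phi> = "\<lambda>t. if t \<le> b then \<Phi>1 t else \<Phi>2 t"
  fix t assume t: "t \<in> {a..c}"
  consider "t < b" | "t = b" | "b < t" by linarith
  then show "\<exists>N G. \<gamma> t \<in> N \<and> locally_biholomorphic_on A G N \<and> ?\<Phi> t = germ_at (\<gamma> t) G \<and>
        (\<forall>\<^sub>F s in at t within {a..c}. \<gamma> s \<in> N \<and> ?\<Phi> s = germ_at (\<gamma> s) G)"
  proof cases
    case 1
    then have mem: "t \<in> {a..b}" using t by simp
    have at: "at t within {a..c} = at t within {a..b}"
      by (rule at_within_nhd[where S = "{..<b}"]) (use \<open>t < b\<close> abc in auto)
    obtain N G where N: "\<gamma> t \<in> N" "locally_biholomorphic_on A G N" "\<Phi>1 t = germ_at (\<gamma> t) G"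
      "\<forall>\<^sub>F s in at t within {a..b}. \<gamma> s \<in> N \<and> \<Phi>1 s = germ_at (\<gamma> s) G"
      by (rule continuation_betweenE[OF \<Phi>1 mem])
    have "\<forall>\<^sub>F s in at t within {a..b}. s \<in> {a..b}" by (rule eventually_at_topological[THEN iffD2]) auto
    with N(4) have "\<forall>\<^sub>F s in at t within {a..b}. \<gamma> s \<in> N \<and> ?\<Phi> s = germ_at (\<gamma> s) G"
      by eventually_elim auto
    moreover have "?\<Phi> t = germ_at (\<gamma> t) G" using N(3) \<open>t < b\<close> by simp
    ultimately show ?thesis unfolding at using N(1,2) by (intro exI conjI)
  next
    case 3
    then have mem: "t \<in> {b..c}" using t by simp
    have at: "at t within {a..c} = at t within {b..c}"
      by (rule at_within_nhd[where S = "{b<..}"]) (use \<open>b < t\<close> abc in auto)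
    obtain N G where N: "\<gamma> t \<in> N" "locally_biholomorphic_on A G N" "\<Phi>2 t = germ_at (\<gamma> t) G"
      "\<forall>\<^sub>F s in at t within {b..c}. \<gamma> s \<in> N \<and> \<Phi>2 s = germ_at (\<gamma> s) G"
      by (rule continuation_betweenE[OF \<Phi>2 mem])
    have "\<forall>\<^sub>F s in at t within {b..c}. s \<in> {b<..}"
      using \<open>b < t\<close> by (intro eventually_at_topological[THEN iffD2] exI[of _ "{b<..}"]) auto
    with N(4) have "\<forall>\<^sub>F s in at t within {b..c}. \<gamma> s \<in> N \<and> ?\<Phi> s = germ_at (\<gamma> s) G"
      by eventually_elim auto
    moreover have "?\<Phi> t = germ_at (\<gamma> t) G" using N(3) \<open>b < t\<close> by simp
    ultimately show ?thesis unfolding at using N(1,2) by (intro exI conjI)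
  next
    case 2
    have mem: "b \<in> {a..b}" "b \<in> {b..c}" using abc by auto
    obtain N1 G1 where N1: "\<gamma> b \<in> N1" "locally_biholomorphic_on A G1 N1" "\<Phi>1 b = germ_at (\<gamma> b) G1"
      "\<forall>\<^sub>F s in at b within {a..b}. \<gamma> s \<in> N1 \<and> \<Phi>1 s = germ_at (\<gamma> s) G1"
      by (rule continuation_betweenE[OF \<Phi>1 mem(1)])
    obtain N2 G2 where N2: "\<gamma> b \<in> N2" "locally_biholomorphic_on A G2 N2" "\<Phi>2 b = germ_at (\<gamma> b) G2"
      "\<forall>\<^sub>F s in at b within {b..c}. \<gamma> s \<in> N2 \<and> \<Phi>2 s = germ_at (\<gamma> s) G2"
      by (rule continuation_betweenE[OF \<Phi>2 mem(2)])
    have "germ_at (\<gamma> b) G1 = germ_at (\<gamma> b) G2" using N1(3) N2(3) meet by simp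
    then obtain B where B: "open B" "\<gamma> b \<in> B" "\<forall>y\<in>B. G1 y = G2 y"
      using germ_at_eqD unfolding eventually_nhds by meson
    have same: "germ_at y G1 = germ_at y G2" if "y \<in> B" for y
      by (rule germ_at_eq) (use B that in \<open>auto simp: eventually_nhds\<close>)
    have "(\<gamma> \<longlongrightarrow> \<gamma> b) (at b within {a..c})" using \<gamma> abc by (auto simp: continuous_on_def)
    then have evB: "\<forall>\<^sub>F s in at b within {a..c}. \<gamma> s \<in> B" using B(1,2) by (rule topological_tendstoD)
    have oN2: "open N2" using N2(2) by (simp add: locally_biholomorphic_on_def)
    have "(\<gamma> \<longlongrightarrow> \<gamma> b) (at b within {a..c})" using \<gamma> abc by (auto simp: continuous_on_def)
    then have evN2: "\<forall>\<^sub>F s in at b within {a..c}. \<gamma> s \<in> N2" using oN2 N2(1) by (rule topological_tendstoD)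
    have split: "at b within {a..c} = sup (at b within {a..b}) (at b within {b..c})"
      using abc by (simp flip: at_within_union add: ivl_disj_un)
    have "\<forall>\<^sub>F s in at b within {a..b}. \<gamma> s \<in> N2 \<and> ?\<Phi> s = germ_at (\<gamma> s) G2"
    proof -
      have in_ab: "\<forall>\<^sub>F s in at b within {a..b}. s \<in> {a..b}" by (rule eventually_at_topological[THEN iffD2]) auto
      have "\<forall>\<^sub>F s in at b within {a..b}. \<gamma> s \<in> B" "\<forall>\<^sub>F s in at b within {a..b}. \<gamma> s \<in> N2"
        using evB evN2 unfolding split eventually_sup by auto
      with N1(4) in_ab show ?thesis by eventually_elim (auto simp: same)
    qed
    moreover have "\<forall>\<^sub>F s in at b within {b..c}. \<gamma> s \<in> N2 \<and> ?\<Phi> s = germ_at (\<gamma> s) G2"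
    proof -
      have "\<forall>\<^sub>F s in at b within {b..c}. s \<in> {b..c} \<and> s \<noteq> b"
        by (auto simp: eventually_at_topological)
      with N2(4) show ?thesis by eventually_elim auto
    qed
    ultimately have "\<forall>\<^sub>F s in at b within {a..c}. \<gamma> s \<in> N2 \<and> ?\<Phi> s = germ_at (\<gamma> s) G2"
      unfolding split eventually_sup by blast
    moreover have "?\<Phi> b = germ_at (\<gamma> b) G2" using N2(3) meet by simp
    ultimately show ?thesis unfolding 2 using N2(1,2) by (intro exI conjI)
  qed
qed

lemma continuation_within_chart:
  fixes A :: "('a::t2_space set \<times> ('a \<Rightarrow> 'n::finite cspace)) set"
  assumes A: "complex_atlas A" and \<psi>: "biholomorphic_on A \<psi> W"
    and M: "\<psi> ` (W \<inter> M) = \<psi> ` W \<inter> hyperquadric P"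
    and \<gamma>: "\<And>t. t \<in> {a..b} \<Longrightarrow> \<gamma> t \<in> W \<inter> M" and ab: "a \<le> b"
    and g: "sphere_germ A M (\<gamma> a) g"
  shows "\<exists>\<Phi> h. continuation_between A \<gamma> a b \<Phi> \<and> \<Phi> a = germ_at (\<gamma> a) g \<and>
    \<Phi> b = germ_at (\<gamma> b) h \<and> sphere_germ A M (\<gamma> b) h"
proof -
  obtain N where N: "\<gamma> a \<in> N" "locally_biholomorphic_on A g N" "g ` (N \<inter> M) \<subseteq> sphere 0 1"
    using g unfolding sphere_germ_def by blast
  have "\<gamma> a \<in> W" "\<gamma> a \<in> M" using \<gamma>[of a] ab by auto
  then obtain G N' where G: "locally_biholomorphic_on A G N'" "W \<inter> M \<subseteq> N'"
    "G ` (N' \<inter> M) \<subseteq> sphere 0 1" "\<forall>\<^sub>F y in nhds (\<gamma> a). G y = g y"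
    using extension_over_spherical_chart[OF A \<psi> M _ _ N] by blast
  show ?thesis
  proof (intro exI conjI)
    show "continuation_between A \<gamma> a b (\<lambda>t. germ_at (\<gamma> t) G)"
      unfolding continuation_between_def
    proof
      fix t assume t: "t \<in> {a..b}"
      have "\<forall>\<^sub>F s in at t within {a..b}. s \<in> {a..b}" by (rule eventually_at_topological[THEN iffD2]) auto
      then have "\<forall>\<^sub>F s in at t within {a..b}. \<gamma> s \<in> N' \<and> germ_at (\<gamma> s) G = germ_at (\<gamma> s) G"
        by eventually_elim (use \<gamma> G(2) in blast)
      moreover have "\<gamma> t \<in> N'" using \<gamma>[OF t] G(2) by blast
      ultimately show "\<exists>N G'. \<gamma> t \<in> N \<and> locally_biholomorphic_on A G' N \<and> germ_at (\<gamma> t) G = germ_at (\<gamma> t) G' \<and>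
          (\<forall>\<^sub>F s in at t within {a..b}. \<gamma> s \<in> N \<and> germ_at (\<gamma> s) G = germ_at (\<gamma> s) G')"
        using G(1) by blast
    qed
    show "germ_at (\<gamma> a) G = germ_at (\<gamma> a) g" by (rule germ_at_eq[OF G(4)])
    show "germ_at (\<gamma> b) G = germ_at (\<gamma> b) G" ..
    show "sphere_germ A M (\<gamma> b) G"
      unfolding sphere_germ_def using G(1,2,3) \<gamma>[of b] ab by auto
  qed
qed

theorem theorem5p1:
  fixes A :: "('a::t2_space set \<times> ('a \<Rightarrow> 'n::finite cspace)) set"
    and M U :: "'a set" and p :: 'a and \<phi> :: "'a \<Rightarrow> 'n cspace" and \<gamma> :: "real \<Rightarrow> 'a"
  assumes "complex_atlas A"
    and "spherical A M"
    and "levi_definite A M"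
    and "p \<in> M"
    and "open U" and "connected U" and "p \<in> U"
    and "biholomorphic_on A \<phi> U"
    and "\<phi> ` (U \<inter> M) \<subseteq> sphere 0 1"
    and "path \<gamma>" and "path_image \<gamma> \<subseteq> M" and "pathstart \<gamma> = p"
  shows "continues_along A \<phi> \<gamma>"
proof -
  have cont: "continuous_on {0..1} \<gamma>" using \<open>path \<gamma>\<close> by (simp add: path_def)
  have \<gamma>M: "\<gamma> t \<in> M" if "t \<in> {0..1}" for t
    using \<open>path_image \<gamma> \<subseteq> M\<close> that by (auto simp: path_image_def)
  \<comment> \<open>Every sphere germ at \<open>\<gamma> a\<close> continues to \<open>\<gamma> b\<close>; this passes to adjoining intervals and holds on short ones.\<close>
  define Q where "Q a b \<longleftrightarrow> (0 \<le> a \<longrightarrow> a \<le> b \<longrightarrow> b \<le> 1 \<longrightarrow> (\<forall>g. sphere_germ A M (\<gamma> a) g \<longrightarrow>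
    (\<exists>\<Phi> h. continuation_between A \<gamma> a b \<Phi> \<and> \<Phi> a = germ_at (\<gamma> a) g \<and>
       \<Phi> b = germ_at (\<gamma> b) h \<and> sphere_germ A M (\<gamma> b) h)))" for a b
  have "Q 0 1"
  proof (rule Bolzano)
    fix a b c assume Q: "Q a b" "Q b c" and abc: "a \<le> b" "b \<le> c"
    show "Q a c"
      unfolding Q_def
    proof (intro impI allI)
      fix g assume ac: "0 \<le> a" "c \<le> 1" and g: "sphere_germ A M (\<gamma> a) g"
      obtain \<Phi>1 h1 where 1: "continuation_between A \<gamma> a b \<Phi>1" "\<Phi>1 a = germ_at (\<gamma> a) g"
        "\<Phi>1 b = germ_at (\<gamma> b) h1" "sphere_germ A M (\<gamma> b) h1"
        using Q(1) abc ac g unfolding Q_def by (meson order_trans)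
      obtain \<Phi>2 h2 where 2: "continuation_between A \<gamma> b c \<Phi>2" "\<Phi>2 b = germ_at (\<gamma> b) h1"
        "\<Phi>2 c = germ_at (\<gamma> c) h2" "sphere_germ A M (\<gamma> c) h2"
        using Q(2) abc ac 1(4) unfolding Q_def by (meson order_trans)
      have "continuous_on {a..c} \<gamma>" using ac by (intro continuous_on_subset[OF cont]) auto
      then have "continuation_between A \<gamma> a c (\<lambda>t. if t \<le> b then \<Phi>1 t else \<Phi>2 t)"
        using 1 2 abc by (intro continuation_join[OF \<open>complex_atlas A\<close>]) auto
      then show "\<exists>\<Phi> h. continuation_between A \<gamma> a c \<Phi> \<and> \<Phi> a = germ_at (\<gamma> a) g \<and>
          \<Phi> c = germ_at (\<gamma> c) h \<and> sphere_germ A M (\<gamma> c) h"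
        using 1 2 abc by (intro exI[of _ "\<lambda>t. if t \<le> b then \<Phi>1 t else \<Phi>2 t"] exI[of _ h2]) auto
    qed
  next
    fix x :: real assume x: "0 \<le> x" "x \<le> 1"
    then obtain W \<psi> P where W: "\<gamma> x \<in> W" "biholomorphic_on A \<psi> W"
      "\<psi> ` (W \<inter> M) = \<psi> ` W \<inter> hyperquadric P"
      using \<open>spherical A M\<close> \<gamma>M[of x] unfolding spherical_def by (meson atLeastAtMost_iff)
    have "\<exists>d>0. \<forall>s\<in>{0..1}. dist s x < d \<longrightarrow> \<gamma> s \<in> W"
    proof -
      have "(\<gamma> \<longlongrightarrow> \<gamma> x) (at x within {0..1})" using cont x by (auto simp: continuous_on_def)
      then have "\<forall>\<^sub>F s in at x within {0..1}. \<gamma> s \<in> W"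
        using biholomorphic_onD(1)[OF W(2)] W(1) by (rule topological_tendstoD)
      then obtain d where d: "d > 0" "\<forall>s\<in>{0..1}. s \<noteq> x \<and> dist s x < d \<longrightarrow> \<gamma> s \<in> W"
        unfolding eventually_at by blast
      then have "\<forall>s\<in>{0..1}. dist s x < d \<longrightarrow> \<gamma> s \<in> W" using W(1) by (metis (full_types))
      then show ?thesis using d(1) by blast
    qed
    then obtain d where d: "d > 0" "\<forall>s\<in>{0..1}. dist s x < d \<longrightarrow> \<gamma> s \<in> W" by blast
    have "Q a b" if ab: "a \<le> x" "x \<le> b" "b - a < d" for a b
      unfolding Q_def
    proof (intro impI allI)
      fix g assume bd: "0 \<le> a" "a \<le> b" "b \<le> 1" and g: "sphere_germ A M (\<gamma> a) g"
      have inWM: "\<gamma> t \<in> W \<inter> M" if "t \<in> {a..b}" for t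
        using that ab bd d(2) \<gamma>M[of t] by (auto simp: dist_real_def)
      show "\<exists>\<Phi> h. continuation_between A \<gamma> a b \<Phi> \<and> \<Phi> a = germ_at (\<gamma> a) g \<and>
          \<Phi> b = germ_at (\<gamma> b) h \<and> sphere_germ A M (\<gamma> b) h"
        by (rule continuation_within_chart[where \<gamma> = \<gamma> and a = a and b = b,
              OF \<open>complex_atlas A\<close> W(2,3) inWM bd(2) g])
    qed
    then show "\<exists>d>0. \<forall>a b. a \<le> x \<and> x \<le> b \<and> b - a < d \<longrightarrow> Q a b" using d(1) by blast
  qed simp
  moreover have "sphere_germ A M (\<gamma> 0) \<phi>"
    unfolding sphere_germ_def locally_biholomorphic_on_def
    using assms(5,7,8,9,12) by (intro exI[of _ U]) (auto simp: pathstart_def)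
  ultimately obtain \<Phi> where "continuation_between A \<gamma> 0 1 \<Phi>" "\<Phi> 0 = germ_at (\<gamma> 0) \<phi>"
    unfolding Q_def by (metis order_refl zero_le_one)
  then show ?thesis unfolding continues_along_def continuation_between_def by blast
qed

end
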